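(* Let $\mathcal{H}=([n],E(\mathcal{H}))$ be a hypergraph, $r\geq 2$ an integer, $\boldsymbol{s}=(s_1,\ldots,s_n)$ a positive integer vector, and let $\mu(r)$ be the largest prime factor of $r$. If $1\leq s_i<\mu(r)$ for each $i\in[n]$, then $$\chi(\operatorname{KG}^r_{\boldsymbol{s}}(\mathcal{H}))\geq\left\lceil\frac{\operatorname{ecd}^r_{\boldsymbol{s}}(\mathcal{H})}{r-1}\right\rceil.$$
   Context: $[n]=\{1,\ldots,n\}$. A hypergraph $\mathcal{H}$ is a pair $(V(\mathcal{H}),E(\mathcal{H}))$ where $V(\mathcal{H})$ is a finite set and $E(\mathcal{H})$ is a family (set) of nonempty subsets of $V(\mathcal{H})$. For $N\subseteq V(\mathcal{H})$, $\mathcal{H}[N]$ is the hypergraph with vertex set $N$ and edge set $\{e\in E(\mathcal{H}): e\subseteq N\}$. Let $r\ge 2$ be an integer and $\boldsymbol{s}=(s_1,\ldots,s_n)$ an integer vector with $1\leq s_i<r$. A multiset $\{N_1,\ldots,N_r\}$ of $r$ subsets of $[n]$ is $\boldsymbol{s}$-disjoint if each $i\in[n]$ belongs to at most $s_i$ of the sets $N_j$ (counting repetitions); it is equitable if the sizes $|N_j|$ pairwise differ by at most one; it is equitable $\boldsymbol{s}$-disjoint if it is both. The $\boldsymbol{s}$-disjoint general Kneser hypergraph $\operatorname{KG}^r_{\boldsymbol{s}}(\mathcal{H})$ is the $r$-uniform (multi-)hypergraph with vertex set $E(\mathcal{H})$ whose edges are all multisets $\{e_1,\ldots,e_r\}$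 with $e_1,\ldots,e_r\in E(\mathcal{H})$ (repetitions allowed) that are $\boldsymbol{s}$-disjoint. A proper coloring is an assignment of colors to the vertices such that no edge is monochromatic, and $\chi$ is the minimum number of colors in a proper coloring. The equitable $\boldsymbol{s}$-disjoint $r$-colorability defect is $$\operatorname{ecd}^r_{\boldsymbol{s}}(\mathcal{H})=\sum_{i=1}^n s_i-\max\Bigl\{\sum_{j=1}^r|N_j| : N_j\subseteq[n],\ \{N_1,\ldots,N_r\}\text{ is equitable } \boldsymbol{s}\text{-disjoint and } E(\mathcal{H}[N_j])=\varnothing \text{ for each } j\in[r]\Bigr\}.$$ *)

theory Defs
  imports Complex_Main "HOL-Library.Multiset" "HOL-Computational_Algebra.Primes"
begin

type_synonym 'a hypergraph = "'a set \<times> 'a set set"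

abbreviation verts :: "'a hypergraph \<Rightarrow> 'a set" where
  "verts H \<equiv> fst H"

abbreviation edges :: "'a hypergraph \<Rightarrow> 'a set set" where
  "edges H \<equiv> snd H"

definition hypergraph :: "'a hypergraph \<Rightarrow> bool" where
  "hypergraph H \<longleftrightarrow> finite (verts H) \<and> (\<forall>e\<in>edges H. e \<noteq> {} \<and> e \<subseteq> verts H)"

definition induced :: "'a hypergraph \<Rightarrow> 'a set \<Rightarrow> 'a hypergraph" where
  "induced H N = (N, {e \<in> edges H. e \<subseteq> N})"

definition s_disjoint :: "'a set \<Rightarrow> ('a \<Rightarrow> nat) \<Rightarrow> 'a set multiset \<Rightarrow> bool" where
  "s_disjoint V s M \<longleftrightarrow> (\<forall>i\<in>V. size {#N \<in># M. i \<in> N#} \<le> s i)"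

definition equitable :: "'a set multiset \<Rightarrow> bool" where
  "equitable M \<longleftrightarrow> (\<forall>A\<in>#M. \<forall>B\<in>#M. \<bar>int (card A) - int (card B)\<bar> \<le> 1)"

text \<open>Edges of a multi-hypergraph are multisets, so a vertex may be repeated within an edge.\<close>

type_synonym 'v multi_hypergraph = "'v set \<times> 'v multiset set"

definition kneser :: "nat \<Rightarrow> ('a \<Rightarrow> nat) \<Rightarrow> 'a hypergraph \<Rightarrow> 'a set multi_hypergraph" where
  "kneser r s H =
     (edges H, {M. size M = r \<and> set_mset M \<subseteq> edges H \<and> s_disjoint (verts H) s M})"

definition proper_coloring :: "'v multi_hypergraph \<Rightarrow> ('v \<Rightarrow> 'c) \<Rightarrow> bool" where
  "proper_coloring G c \<longleftrightarrow> (\<forall>e\<in>snd G. \<not> (\<exists>k. \<forall>v\<in>#e. c v = k))"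

text \<open>Meaningful only if some proper coloring with finitely many colors exists;
  for Kneser hypergraphs this is \<open>kneser_colorable\<close> below.\<close>

definition chromatic_number :: "'v multi_hypergraph \<Rightarrow> nat" where
  "chromatic_number G =
     (LEAST k. \<exists>c :: 'v \<Rightarrow> nat. proper_coloring G c \<and> c ` fst G \<subseteq> {..<k})"

definition ecd_families :: "nat \<Rightarrow> ('a \<Rightarrow> nat) \<Rightarrow> 'a hypergraph \<Rightarrow> 'a set multiset set" where
  "ecd_families r s H =
     {M. size M = r \<and> (\<forall>N\<in>#M. N \<subseteq> verts H) \<and> equitable M \<and> s_disjoint (verts H) s M
         \<and> (\<forall>N\<in>#M. edges (induced H N) = {})}"

definition ecd :: "nat \<Rightarrow> ('a \<Rightarrow> nat) \<Rightarrow> 'a hypergraph \<Rightarrow> int" where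
  "ecd r s H =
     int (\<Sum>i\<in>verts H. s i) - int (Max {(\<Sum>N\<in>#M. card N) | M. M \<in> ecd_families r s H})"

definition largest_prime_factor :: "nat \<Rightarrow> nat" where
  "largest_prime_factor r = Max (prime_factors r)"

text \<open>The minimum and the maximum above are attained.\<close>

lemma kneser_colorable:
  fixes H :: "'a hypergraph"
  assumes H: "hypergraph H" and r: "r > 0" and s: "\<forall>i\<in>verts H. s i < r"
  shows "\<exists>k. \<exists>c :: 'a set \<Rightarrow> nat.
           proper_coloring (kneser r s H) c \<and> c ` fst (kneser r s H) \<subseteq> {..<k}"
proof -
  have fin: "finite (edges H)"
    by (rule finite_subset[of _ "Pow (verts H)"]) (use H in \<open>auto simp: hypergraph_def\<close>)
  obtain c :: "'a set \<Rightarrow> nat" and m where c: "c ` edges H = {i. i < m}" "inj_on c (edges H)"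
    using finite_imp_inj_to_nat_seg[OF fin] by blast
  have "proper_coloring (kneser r s H) c"
    unfolding proper_coloring_def
  proof (intro ballI notI)
    fix M assume "M \<in> snd (kneser r s H)" and mono: "\<exists>k. \<forall>v\<in>#M. c v = k"
    then have M: "size M = r" "set_mset M \<subseteq> edges H" "s_disjoint (verts H) s M"
      by (auto simp: kneser_def)
    from M(1) r obtain e where e: "e \<in># M" by (cases M) auto
    with M(2) H obtain i where i: "i \<in> e" "i \<in> verts H"
      unfolding hypergraph_def by blast
    have "f = e" if "f \<in># M" for f
      using mono that e M(2) c(2) by (metis inj_onD subsetD)
    then have "{#N \<in># M. i \<in> N#} = M"
      using i by (metis (mono_tags, lifting) filter_mset_True filter_mset_cong)
    with M(1,3) i(2) s show False
      unfolding s_disjoint_def by force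
  qed
  with c(1) show ?thesis by (auto simp: kneser_def intro!: exI[of _ m] exI[of _ c])
qed

lemma finite_nonempty_ecd_values:
  assumes H: "hypergraph H"
  shows "finite {(\<Sum>N\<in>#M. card N) | M. M \<in> ecd_families r s H}"
    and "{(\<Sum>N\<in>#M. card N) | M. M \<in> ecd_families r s H} \<noteq> {}"
proof -
  have "(\<Sum>N\<in>#M. card N) \<le> r * card (verts H)" if "M \<in> ecd_families r s H" for M
  proof -
    have M: "size M = r" "\<forall>N\<in>#M. N \<subseteq> verts H"
      using that by (auto simp: ecd_families_def)
    have "(\<Sum>N\<in>#M. card N) \<le> (\<Sum>N\<in>#M. card (verts H))"
      using M(2) H by (intro sum_mset_mono) (auto simp: hypergraph_def card_mono)
    with M(1) show ?thesis by simp
  qed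
  then have "{(\<Sum>N\<in>#M. card N) | M. M \<in> ecd_families r s H} \<subseteq> {..r * card (verts H)}"
    by blast
  then show "finite {(\<Sum>N\<in>#M. card N) | M. M \<in> ecd_families r s H}"
    by (rule finite_subset) (rule finite_atMost)
  have no: "{#N \<in># replicate_mset r {}. i \<in> N#} = {#}" for i :: 'a
    by (induction r) auto
  have "s_disjoint (verts H) s (replicate_mset r {})"
    unfolding s_disjoint_def no by simp
  moreover have eq: "N = {}" if "N \<in># replicate_mset r {}" for N :: "'a set"
    using that by (simp split: if_splits)
  moreover have "equitable (replicate_mset r ({} :: 'a set))"
    unfolding equitable_def by (intro ballI) (simp add: eq del: set_mset_replicate_mset_subset)
  moreover have "edges (induced H {}) = {}"
    using H by (auto simp: induced_def hypergraph_def)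
  ultimately have "replicate_mset r {} \<in> ecd_families r s H"
    unfolding ecd_families_def by (auto split: if_splits)
  then show "{(\<Sum>N\<in>#M. card N) | M. M \<in> ecd_families r s H} \<noteq> {}" by blast
qed

end

theory Submission
  imports Defs "HOL-Number_Theory.Cong"
begin

text \<open>
  Suppose first that \<open>r = p\<close> is prime. Families \<open>N\<^sub>1, \<dots>, N\<^sub>p\<close> that are \<open>s\<close>-disjoint form a join of
  skeleta of simplices, on which \<open>\<int>/p\<close> acts freely. Give a family without edges the size of its
  largest equitable subfamily as level, and any other family \<open>\<alpha>\<close> plus the number of pairs
  (\<open>j\<close>, colour of an edge inside \<open>N\<^sub>j\<close>), where \<open>\<alpha>\<close> is the maximum in the definition of the defect.
  Levels are monotone and at most \<open>\<alpha> + C (p - 1)\<close>, since a proper colouring lets no colour occur in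
  all \<open>N\<^sub>j\<close>, and an equivariant sign can be chosen that is constant along chains of equal level.
  A Tucker lemma then yields a flag of length \<open>\<Sum>s\<^sub>i\<close> along which consecutive signs differ, so that
  the level increases strictly.

  The Tucker lemma pairs explicit chains, built by coning with fixed vertices and alternately
  applying \<open>g - 1\<close> and the norm, with cochains built from the sign by alternately taking
  coboundaries modulo \<open>p\<close> and Bockstein-type quotients by \<open>p\<close>. The pairing is \<open>1\<close> modulo \<open>p\<close>, and
  the cochains vanish on simplices carrying no flag with distinct consecutive signs.

  For \<open>r = p q\<close> with \<open>p\<close> the largest prime factor, apply the result for \<open>q\<close> and pairwise disjoint
  sets inside each \<open>W \<subseteq> V\<close>: where the conclusion fails, \<open>W\<close> contains \<open>q\<close> disjoint edges of one
  colour. The prime case for the hypergraph of such \<open>W\<close>, coloured by this colour, finishes the proof.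
\<close>

section \<open>Cochains on ordered simplices\<close>

text \<open>The simplicial coboundary: the recursion unfolds to the alternating sum over the
  deletions of one entry. The empty list counts as a face, so the complex is augmented.\<close>

fun cobd :: "('v list \<Rightarrow> int) \<Rightarrow> 'v list \<Rightarrow> int" where
  "cobd f [] = 0"
| "cobd f (x # xs) = f xs - cobd (\<lambda>ys. f (x # ys)) xs"

text \<open>Faces are described by their multisets only, because closure of \<open>good\<close> and
  growth of \<open>lev\<close> are stated in these terms.\<close>

lemma cobd_cong_mod:
  assumes "\<And>Y. mset Y \<subseteq># mset X \<Longrightarrow> Suc (length Y) = length X \<Longrightarrow> [f Y = g Y] (mod m)"
  shows "[cobd f X = cobd g X] (mod m)"
  using assms
proof (induction X arbitrary: f g)
  case (Cons x xs)
  have "[cobd (\<lambda>ys. f (x # ys)) xs = cobd (\<lambda>ys. g (x # ys)) xs] (mod m)"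
    by (rule Cons.IH, rule Cons.prems) auto
  moreover have "[f xs = g xs] (mod m)"
    by (rule Cons.prems) auto
  ultimately show ?case by (simp add: cong_diff)
qed simp

lemma cobd_cong:
  assumes "\<And>Y. mset Y \<subseteq># mset X \<Longrightarrow> Suc (length Y) = length X \<Longrightarrow> f Y = g Y"
  shows "cobd f X = cobd g X"
  using cobd_cong_mod[of X f g 0] assms by simp

lemma cobd_diff: "cobd (\<lambda>Y. f Y - g Y) X = cobd f X - cobd g X"
  by (induction X arbitrary: f g) auto

lemma cobd_add: "cobd (\<lambda>Y. f Y + g Y) X = cobd f X + cobd g X"
  by (induction X arbitrary: f g) auto

lemma cobd_cmult: "cobd (\<lambda>Y. c * f Y) X = c * cobd f X"
  by (induction X arbitrary: f) (auto simp: right_diff_distrib)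

lemma cobd_const_zero: "cobd (\<lambda>Y. 0) X = 0"
  by (induction X) auto

lemma cobd_one: "cobd (\<lambda>Y. 1) X = of_bool (odd (length X))"
  by (induction X) auto

lemma cobd_cobd: "cobd (cobd f) X = 0"
  by (induction X arbitrary: f) (auto simp: cobd_diff)

lemma cobd_map: "cobd f (map h X) = cobd (\<lambda>Y. f (map h Y)) X"
  by (induction X arbitrary: f) auto

lemma cobd_nonzero:
  assumes "cobd f X \<noteq> 0"
  obtains Y where "mset Y \<subseteq># mset X" "Suc (length Y) = length X" "f Y \<noteq> 0"
  using assms cobd_cong[of X f "\<lambda>_. 0"] cobd_const_zero[of X] by metis

section \<open>Equivariant chains\<close>

text \<open>\<open>rot p 0\<close> reduces the second components modulo \<open>p\<close> and need
  not be the identity. It stands where the identity is expected, so that sums over all shifts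
  telescope exactly.\<close>

definition rot :: "nat \<Rightarrow> nat \<Rightarrow> ('a \<times> nat) list \<Rightarrow> ('a \<times> nat) list" where
  "rot p k = map (\<lambda>(i, x). (i, (x + k) mod p))"

lemma rot_simps [simp]:
  "map fst (rot p k X) = map fst X" "length (rot p k X) = length X"
  by (auto simp: rot_def)

lemma rot_rot: "rot p k (rot p l X) = rot p (k + l) X"
  by (auto simp: rot_def mod_simps ac_simps)

lemma rot_period: "rot p p X = rot p 0 X"
  by (auto simp: rot_def)

lemma cobd_rot: "cobd f (rot p k X) = cobd (\<lambda>Y. f (rot p k Y)) X"
  unfolding rot_def by (rule cobd_map)

text \<open>A chain is represented by the functional that evaluates cochains on it. \<open>eqch p op\<close> applies
  \<open>g - 1\<close> or the norm \<open>1 + g + \<dots> + g\<^sup>p\<^sup>-\<^sup>1\<close> to a chain, alternately by degree; each chain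
  is the cone over the image of the preceding one.\<close>

definition eqch :: "nat \<Rightarrow> nat \<Rightarrow> ((('a \<times> nat) list \<Rightarrow> int) \<Rightarrow> int)
    \<Rightarrow> (('a \<times> nat) list \<Rightarrow> int) \<Rightarrow> int" where
  "eqch p l c f =
     (if l = 0 then c f
      else if odd l then c (\<lambda>X. f (rot p 1 X)) - c (\<lambda>X. f (rot p 0 X))
      else (\<Sum>k<p. c (\<lambda>X. f (rot p k X))))"

primrec chain :: "nat \<Rightarrow> 'a list \<Rightarrow> (('a \<times> nat) list \<Rightarrow> int) \<Rightarrow> int" where
  "chain p [] f = f []"
| "chain p (b # bs) f = eqch p (length bs) (chain p bs) (\<lambda>X. f ((b, 0) # X))"

lemma chain_cong_mod:
  assumes "\<And>X. map fst X = bs \<Longrightarrow> [f X = g X] (mod m)"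
  shows "[chain p bs f = chain p bs g] (mod m)"
  using assms
proof (induction bs arbitrary: f g)
  case (Cons b bs)
  have *: "[chain p bs (\<lambda>X. f ((b, 0) # rot p k X)) = chain p bs (\<lambda>X. g ((b, 0) # rot p k X))] (mod m)"
    for k by (rule Cons.IH) (auto intro!: Cons.prems)
  have "[chain p bs (\<lambda>X. f ((b, 0) # X)) = chain p bs (\<lambda>X. g ((b, 0) # X))] (mod m)"
    by (rule Cons.IH) (auto intro!: Cons.prems)
  then show ?case by (auto simp: eqch_def intro!: cong_diff cong_sum *)
qed auto

lemma chain_cong:
  assumes "\<And>X. map fst X = bs \<Longrightarrow> f X = g X"
  shows "chain p bs f = chain p bs g"
  using chain_cong_mod[of bs f g 0] assms by simp

lemma chain_diff: "chain p bs (\<lambda>X. f X - g X) = chain p bs f - chain p bs g"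
  by (induction bs arbitrary: f g) (auto simp: eqch_def sum_subtractf)

lemma chain_cmult: "chain p bs (\<lambda>X. c * f X) = c * chain p bs f"
  by (induction bs arbitrary: f) (auto simp: eqch_def sum_distrib_left right_diff_distrib)

lemma eqch_diff: "eqch p l (chain p bs) (\<lambda>X. f X - g X) = eqch p l (chain p bs) f - eqch p l (chain p bs) g"
  by (auto simp: eqch_def chain_diff sum_subtractf)

lemma chain_nonzero:
  assumes "chain p bs f \<noteq> 0"
  obtains X where "map fst X = bs" "f X \<noteq> 0"
proof -
  have "chain p bs (\<lambda>X. 0 * f X) = 0" by (simp only: chain_cmult)
  then show ?thesis using assms chain_cong[of bs f "\<lambda>X. 0 * f X"] that by fastforce
qed

lemma sum_telescope: "(\<Sum>k<n. f (Suc k) - f k :: int) = f n - f 0"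
  by (induction n) auto

text \<open>The boundary of a cone is its base minus the cone over the boundary of the base. The
  base is a cycle, since \<open>g - 1\<close> and the norm annihilate each other.\<close>

lemma chain_cobd:
  assumes "bs \<noteq> []"
  shows "chain p (b # bs) (cobd f) = eqch p (length bs) (chain p bs) f"
  using assms
proof (induction bs arbitrary: b f)
  case (Cons b' bs)
  have "eqch p (length (b' # bs)) (chain p (b' # bs)) (cobd h) = 0" for h
  proof (cases "bs = []")
    case True
    then show ?thesis by (simp add: eqch_def rot_def)
  next
    case False
    have IH: "chain p (b' # bs) (cobd f) = eqch p (length bs) (chain p bs) f" for f
      by (rule Cons.IH[OF False])
    have tel: "(\<Sum>k<p. chain p bs (\<lambda>X. h (rot p (Suc k) X)) - chain p bs (\<lambda>X. h (rot p k X))) = 0"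
      using sum_telescope[of "\<lambda>k. chain p bs (\<lambda>X. h (rot p k X))" p] by (simp add: rot_period)
    show ?thesis
      using False tel
      unfolding eqch_def[of p "length (b' # bs)"] cobd_rot IH
      by (auto simp: eqch_def rot_rot sum_subtractf)
  qed
  then show ?case
    by (simp del: chain.simps add: chain.simps(2)[of p b] eqch_diff)
qed simp

section \<open>A Tucker lemma for cyclic actions\<close>

text \<open>The lists in \<open>good\<close> are the simplices of a complex with an action of
  \<open>Z/p\<close>. By \<open>lev_less\<close> each sign change between a simplex and a face
  raises the level, so flags with many sign changes force high levels.\<close>

locale equivariant_sign =
  fixes p :: nat and good :: "('a \<times> nat) list \<Rightarrow> bool"
    and sgn :: "('a \<times> nat) list \<Rightarrow> int" and lev :: "('a \<times> nat) list \<Rightarrow> nat"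
  assumes p: "p > 1"
    and good_sub: "\<And>X Y. good X \<Longrightarrow> mset Y \<subseteq># mset X \<Longrightarrow> Y \<noteq> [] \<Longrightarrow> good Y"
    and good_rot: "\<And>X k. good X \<Longrightarrow> good (rot p k X)"
    and sgn_rot: "\<And>X k. good X \<Longrightarrow> [sgn (rot p k X) = sgn X + int k] (mod int p)"
    and lev_pos: "\<And>X. good X \<Longrightarrow> lev X > 0"
    and lev_less: "\<And>X Y. good X \<Longrightarrow> mset Y \<subseteq># mset X \<Longrightarrow> Y \<noteq> [] \<Longrightarrow>
                     \<not> [sgn Y = sgn X] (mod int p) \<Longrightarrow> lev Y < lev X"
begin

text \<open>A rotation shifts all signs alike, so only differences of signs are invariant; they are
  measured from a base simplex and represented between 0 and \<open>p - 1\<close>.\<close>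

abbreviation rel :: "('a \<times> nat) list \<Rightarrow> ('a \<times> nat) list \<Rightarrow> int" where
  "rel X Y \<equiv> (sgn Y - sgn X) mod int p"

text \<open>When \<open>F\<close> is an invariant cocycle, \<open>diffc F\<close> is an invariant integral lift of the coboundary of
  \<open>F \<cdot> sgn\<close> modulo \<open>p\<close>, and \<open>carry F\<close> is the coboundary of \<open>diffc F\<close> divided by \<open>p\<close>.\<close>

definition diffc :: "(('a \<times> nat) list \<Rightarrow> int) \<Rightarrow> ('a \<times> nat) list \<Rightarrow> int" where
  "diffc F X = cobd (\<lambda>Y. F Y * rel X Y) X"

definition carry :: "(('a \<times> nat) list \<Rightarrow> int) \<Rightarrow> ('a \<times> nat) list \<Rightarrow> int" where
  "carry F Z = cobd (\<lambda>X. cobd (\<lambda>Y. F Y * of_bool (rel Z Y < rel Z X)) X) Z"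

text \<open>Starting from the constant 1 on vertices, \<open>coc k\<close> is evaluated on lists of
  length \<open>2 * k + 1\<close>, in dimension 2k. It plays the part of the k-th power of the
  degree-two cohomology class of \<open>Z/p\<close>.\<close>

definition coc :: "nat \<Rightarrow> ('a \<times> nat) list \<Rightarrow> int" where
  "coc k = (carry ^^ k) (\<lambda>_. 1)"

lemma coc_simps: "coc 0 = (\<lambda>_. 1)" "coc (Suc k) = carry (coc k)"
  by (auto simp: coc_def)

lemma rel_rot:
  assumes "good X" "good Y"
  shows "rel (rot p k X) (rot p k Y) = rel X Y"
proof -
  have "[sgn (rot p k Y) - sgn (rot p k X) = (sgn Y + int k) - (sgn X + int k)] (mod int p)"
    by (intro cong_diff sgn_rot assms)
  then show ?thesis by (simp add: cong_def)
qed

lemma rel_eq_0: "rel X Y = 0 \<longleftrightarrow> [sgn Y = sgn X] (mod int p)"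
  by (simp add: cong_iff_dvd_diff mod_eq_0_iff_dvd)

lemma carry_rot:
  assumes "good Z" "length Z = l + 2" "l > 0"
    and F: "\<And>X. good X \<Longrightarrow> length X = l \<Longrightarrow> F (rot p k X) = F X"
  shows "carry F (rot p k Z) = carry F Z"
  unfolding carry_def cobd_rot
proof (intro cobd_cong)
  fix X Y assume X: "mset X \<subseteq># mset Z" "Suc (length X) = length Z"
    and Y: "mset Y \<subseteq># mset X" "Suc (length Y) = length X"
  have gX: "good X" using X assms by (intro good_sub[OF assms(1) X(1)]) auto
  have gY: "good Y" using X Y assms by (intro good_sub[OF gX Y(1)]) auto
  show "F (rot p k Y) * of_bool (rel (rot p k Z) (rot p k Y) < rel (rot p k Z) (rot p k X))
      = F Y * of_bool (rel Z Y < rel Z X)"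
    using X Y assms(2) F[OF gY] by (simp add: rel_rot gX gY assms(1))
qed

lemma diffc_rot:
  assumes "good X" "length X = Suc l" "l > 0"
    and F: "\<And>X. good X \<Longrightarrow> length X = l \<Longrightarrow> F (rot p k X) = F X"
  shows "diffc F (rot p k X) = diffc F X"
  unfolding diffc_def cobd_rot
proof (intro cobd_cong)
  fix Y assume Y: "mset Y \<subseteq># mset X" "Suc (length Y) = length X"
  have gY: "good Y" using Y assms by (intro good_sub[OF assms(1) Y(1)]) auto
  show "F (rot p k Y) * rel (rot p k X) (rot p k Y) = F Y * rel X Y"
    using Y assms(2) F[OF gY] by (simp add: rel_rot gY assms(1))
qed

text \<open>Replacing \<open>sgn Y - sgn X\<close> by \<open>sgn Y\<close> alters the coboundary by
  \<open>sgn X\<close> times \<open>cobd F X\<close>, which vanishes.\<close>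

lemma diffc_cong:
  assumes "cobd F X = 0"
  shows "[diffc F X = cobd (\<lambda>Y. F Y * sgn Y) X] (mod int p)"
proof -
  have "[diffc F X = cobd (\<lambda>Y. F Y * sgn Y - sgn X * F Y) X] (mod int p)"
    unfolding diffc_def
  proof (rule cobd_cong_mod)
    fix Y
    have "[F Y * rel X Y = F Y * (sgn Y - sgn X)] (mod int p)"
      by (intro cong_mult cong_refl) (simp add: cong_def)
    then show "[F Y * rel X Y = F Y * sgn Y - sgn X * F Y] (mod int p)"
      by (simp only: right_diff_distrib mult.commute)
  qed
  also have "cobd (\<lambda>Y. F Y * sgn Y - sgn X * F Y) X = cobd (\<lambda>Y. F Y * sgn Y) X"
    using assms by (simp add: cobd_diff cobd_cmult)
  finally show ?thesis .
qed

text \<open>Subtracting two residues taken from the base \<open>Z\<close> borrows \<open>p\<close>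
  exactly when the first is the smaller one.\<close>

lemma rel_carry: "rel X Y = rel Z Y - rel Z X + int p * of_bool (rel Z Y < rel Z X)"
proof -
  have carry: "(u - v) mod m = u - v + m * of_bool (u < v)"
    if "0 \<le> u" "u < m" "0 \<le> v" "v < m" for u v m :: int
  proof (cases "u < v")
    case True
    then have "(u - v + m) mod m = u - v + m"
      using that by (intro mod_pos_pos_trivial) auto
    with True show ?thesis by simp
  qed (use that in auto)
  have "rel X Y = (rel Z Y - rel Z X) mod int p"
    by (simp add: mod_simps)
  with carry[of "rel Z Y" "int p" "rel Z X"] p show ?thesis by simp
qed

text \<open>Insert \<open>rel_carry\<close> with base \<open>Z\<close>: the terms with
  \<open>rel Z Y\<close> form a double coboundary, those with \<open>rel Z X\<close> multiply
  \<open>cobd F X\<close>, and both vanish; only the borrows remain.\<close>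

lemma p_carry:
  assumes Z: "good Z" "length Z = l + 2"
    and F: "\<And>X. good X \<Longrightarrow> length X = Suc l \<Longrightarrow> cobd F X = 0"
  shows "int p * carry F Z = cobd (diffc F) Z"
proof -
  have "cobd (diffc F) Z = cobd (\<lambda>X. cobd (\<lambda>Y. F Y * rel Z Y) X
          + int p * cobd (\<lambda>Y. F Y * of_bool (rel Z Y < rel Z X)) X) Z"
  proof (rule cobd_cong)
    fix X assume X: "mset X \<subseteq># mset Z" "Suc (length X) = length Z"
    have gX: "good X" using X Z by (intro good_sub[OF Z(1) X(1)]) auto
    have "diffc F X = cobd (\<lambda>Y. (F Y * rel Z Y - rel Z X * F Y)
        + int p * (F Y * of_bool (rel Z Y < rel Z X))) X"
      unfolding diffc_def
    proof (rule cobd_cong)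
      fix Y
      show "F Y * rel X Y = F Y * rel Z Y - rel Z X * F Y
          + int p * (F Y * of_bool (rel Z Y < rel Z X))"
        unfolding rel_carry[where X = X and Y = Y and Z = Z] by (simp only: ring_distribs ac_simps)
    qed
    also have "\<dots> = cobd (\<lambda>Y. F Y * rel Z Y) X - rel Z X * cobd F X
        + int p * cobd (\<lambda>Y. F Y * of_bool (rel Z Y < rel Z X)) X"
      by (simp only: cobd_add cobd_diff cobd_cmult)
    finally show "diffc F X = cobd (\<lambda>Y. F Y * rel Z Y) X
          + int p * cobd (\<lambda>Y. F Y * of_bool (rel Z Y < rel Z X)) X"
      using F[OF gX] X Z by simp
  qed
  also have "\<dots> = int p * carry F Z"
    by (simp only: cobd_add cobd_cmult cobd_cobd carry_def)
  finally show ?thesis by simp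
qed

text \<open>A nonzero value needs a face in the support of \<open>F\<close> whose sign differs from
  that of \<open>X\<close>, which costs one level.\<close>

lemma diffc_lev:
  assumes X: "good X" "length X = Suc l" "l > 0" "diffc F X \<noteq> 0"
    and F: "\<And>Y. good Y \<Longrightarrow> length Y = l \<Longrightarrow> F Y \<noteq> 0 \<Longrightarrow> lev Y \<ge> l"
  shows "lev X \<ge> Suc l"
proof -
  obtain Y where Y: "mset Y \<subseteq># mset X" "Suc (length Y) = length X" "F Y * rel X Y \<noteq> 0"
    using X(4) unfolding diffc_def by (rule cobd_nonzero)
  have "good Y" using X Y by (intro good_sub[OF X(1) Y(1)]) auto
  then have "lev Y \<ge> l" using F X Y by auto
  moreover have "lev Y < lev X"
    using Y X by (intro lev_less) (auto simp del: mod_0_imp_dvd simp flip: rel_eq_0)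
  ultimately show ?thesis by simp
qed

text \<open>A borrow \<open>rel Z Y < rel Z X\<close> makes \<open>rel Z X\<close> positive and
  separates the signs of \<open>X\<close> and \<open>Y\<close>, so the level rises twice along the
  flag.\<close>

lemma carry_lev:
  assumes Z: "good Z" "length Z = l + 2" "l > 0" "carry F Z \<noteq> 0"
    and F: "\<And>Y. good Y \<Longrightarrow> length Y = l \<Longrightarrow> F Y \<noteq> 0 \<Longrightarrow> lev Y \<ge> l"
  shows "lev Z \<ge> l + 2"
proof -
  obtain X where X: "mset X \<subseteq># mset Z" "Suc (length X) = length Z"
      "cobd (\<lambda>Y. F Y * of_bool (rel Z Y < rel Z X)) X \<noteq> 0"
    using Z(4) unfolding carry_def by (rule cobd_nonzero)
  obtain Y where Y: "mset Y \<subseteq># mset X" "Suc (length Y) = length X"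
      "F Y * of_bool (rel Z Y < rel Z X) \<noteq> 0"
    using X(3) by (rule cobd_nonzero)
  have gX: "good X" using X Z by (intro good_sub[OF Z(1) X(1)]) auto
  have "good Y" using X Y Z by (intro good_sub[OF gX Y(1)]) auto
  then have "lev Y \<ge> l" using F X Y Z by auto
  moreover have less: "rel Z Y < rel Z X" using Y(3) by (auto split: if_splits)
  have "lev X < lev Z"
  proof (rule lev_less)
    have "rel Z X \<noteq> 0" using less pos_mod_sign[of "int p" "sgn Y - sgn Z"] p by linarith
    then show "\<not> [sgn X = sgn Z] (mod int p)" by (simp only: rel_eq_0 not_False_eq_True)
  qed (use X Z in auto)
  moreover have "lev Y < lev X"
  proof (rule lev_less)
    show "\<not> [sgn Y = sgn X] (mod int p)"
      using less cong_diff[OF _ cong_refl, of "sgn Y" "sgn X" "int p" "sgn Z"]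
      unfolding cong_def by linarith
  qed (use X Y Z gX in auto)
  ultimately show ?thesis by simp
qed

text \<open>The cocycle property passes through \<open>p_carry\<close>: \<open>p\<close> times the
  next cochain is a coboundary, and \<open>p\<close> cancels in the integers.\<close>

lemma coc_props:
  "good X \<Longrightarrow> length X = 2 * k + 2 \<Longrightarrow> cobd (coc k) X = 0"
  "good X \<Longrightarrow> length X = 2 * k + 1 \<Longrightarrow> coc k (rot p j X) = coc k X"
  "good X \<Longrightarrow> length X = 2 * k + 1 \<Longrightarrow> coc k X \<noteq> 0 \<Longrightarrow> lev X \<ge> 2 * k + 1"
proof (induction k arbitrary: X j)
  case 0
  {
    case 1 then show ?case by (simp add: coc_simps cobd_one)
  next
    case 2 then show ?case by (simp add: coc_simps)
  next
    case 3 then show ?case using lev_pos[of X] by simp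
  }
next
  case (Suc k)
  have c: "int p * coc (Suc k) Z = cobd (diffc (coc k)) Z"
    if "good Z" "length Z = 2 * k + 3" for Z
    unfolding coc_simps by (rule p_carry[where l = "2 * k + 1"]) (use that Suc.IH(1) in auto)
  {
    case 1
    have "int p * cobd (coc (Suc k)) X = cobd (cobd (diffc (coc k))) X"
      unfolding cobd_cmult[symmetric]
    proof (rule cobd_cong)
      fix Y assume Y: "mset Y \<subseteq># mset X" "Suc (length Y) = length X"
      then have "good Y" using 1 by (intro good_sub[OF 1(1) Y(1)]) auto
      then show "int p * coc (Suc k) Y = cobd (diffc (coc k)) Y"
        using 1 Y by (intro c) auto
    qed
    then show ?case using p by (simp add: cobd_cobd)
  next
    case 2
    then show ?case unfolding coc_simps
      by (intro carry_rot[where l = "2 * k + 1"]) (use Suc.IH(2) in auto)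
  next
    case 3
    then show ?case using carry_lev[of X "2 * k + 1" "coc k"] Suc.IH(3) by (auto simp: coc_simps)
  }
qed

text \<open>Since \<open>bs\<close> has odd length, the boundary of the cone is \<open>g - 1\<close>
  applied to the smaller chain. A rotation by 1 adds 1 to the sign and fixes \<open>coc k\<close>,
  so the product of \<open>coc k\<close> and \<open>sgn\<close> changes by
  \<open>coc k\<close>.\<close>

lemma chain_diffc:
  assumes good: "\<And>X. map fst X = b # bs \<Longrightarrow> good X" and len: "length bs = 2 * k + 1"
  shows "[chain p (b # bs) (diffc (coc k)) = chain p bs (coc k)] (mod int p)"
proof -
  have good': "good X" if "map fst X = bs" for X
    using len that by (intro good_sub[OF good[of "(b, 0) # X"]]) auto
  have lenX: "length X = length cs" if "map fst X = cs" for X :: "('a \<times> nat) list" and cs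
    using that by auto
  have "[chain p (b # bs) (diffc (coc k))
      = chain p (b # bs) (cobd (\<lambda>Y. coc k Y * sgn Y))] (mod int p)"
  proof (rule chain_cong_mod)
    fix X :: "('a \<times> nat) list" assume X: "map fst X = b # bs"
    show "[diffc (coc k) X = cobd (\<lambda>Y. coc k Y * sgn Y) X] (mod int p)"
      using good[OF X] lenX[OF X] len by (intro diffc_cong coc_props(1)) auto
  qed
  also have "chain p (b # bs) (cobd (\<lambda>Y. coc k Y * sgn Y))
      = chain p bs (\<lambda>X. coc k (rot p 1 X) * sgn (rot p 1 X))
        - chain p bs (\<lambda>X. coc k (rot p 0 X) * sgn (rot p 0 X))"
    using len by (subst chain_cobd) (auto simp: eqch_def)
  also have "\<dots> = chain p bs (\<lambda>X. coc k (rot p 1 X) * sgn (rot p 1 X)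
        - coc k (rot p 0 X) * sgn (rot p 0 X))"
    by (simp only: chain_diff)
  also have "[\<dots> = chain p bs (coc k)] (mod int p)"
  proof (rule chain_cong_mod)
    fix X :: "('a \<times> nat) list" assume X: "map fst X = bs"
    have inv: "coc k (rot p j X) = coc k X" for j
      using good'[OF X] lenX[OF X] len by (intro coc_props(2)) auto
    have "[coc k X * sgn (rot p 1 X) - coc k X * sgn (rot p 0 X)
        = coc k X * (sgn X + int 1) - coc k X * (sgn X + int 0)] (mod int p)"
      by (intro cong_diff cong_mult cong_refl sgn_rot good'[OF X])
    then show "[coc k (rot p 1 X) * sgn (rot p 1 X) - coc k (rot p 0 X) * sgn (rot p 0 X)
        = coc k X] (mod int p)"
      unfolding inv by (simp add: algebra_simps)
  qed
  finally show ?thesis .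
qed

text \<open>Two vertices are removed at a time. The first gives a norm, whose \<open>p\<close> equal
  contributions cancel the factor \<open>p\<close> of \<open>p_carry\<close>; the second is handled
  by \<open>chain_diffc\<close>.\<close>

lemma chain_coc:
  assumes "\<And>X. map fst X = bs \<Longrightarrow> good X" and "length bs = 2 * k + 1"
  shows "[chain p bs (coc k) = 1] (mod int p)"
  using assms
proof (induction k arbitrary: bs)
  case 0
  then obtain b where "bs = [b]" by (auto simp: length_Suc_conv)
  then show ?case by (simp add: eqch_def coc_simps)
next
  case (Suc k)
  then obtain b' b cs where bs: "bs = b' # b # cs" and len: "length cs = 2 * k + 1"
    by (auto simp: length_Suc_conv)
  have good1: "good X" if "map fst X = b # cs" for X
    using that by (intro good_sub[OF Suc.prems(1)[of "(b', 0) # X"]]) (auto simp: bs)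
  have good2: "good X" if "map fst X = cs" for X
    using that len by (intro good_sub[OF good1[of "(b, 0) # X"]]) auto
  have lenX: "length X = length cs" if "map fst X = cs" for X :: "('a \<times> nat) list" and cs
    using that by auto
  have "int p * chain p bs (coc (Suc k)) = chain p bs (cobd (diffc (coc k)))"
    unfolding chain_cmult[symmetric] coc_simps
  proof (rule chain_cong)
    fix X :: "('a \<times> nat) list" assume X: "map fst X = bs"
    show "int p * carry (coc k) X = cobd (diffc (coc k)) X"
      using Suc.prems(1)[OF X] lenX[OF X] Suc.prems(2)
      by (intro p_carry[where l = "2 * k + 1"] coc_props(1)) auto
  qed
  also have "\<dots> = (\<Sum>j<p. chain p (b # cs) (\<lambda>X. diffc (coc k) (rot p j X)))"
    using len unfolding bs by (subst chain_cobd) (auto simp: eqch_def)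
  also have "\<dots> = (\<Sum>j<p. chain p (b # cs) (diffc (coc k)))"
  proof (intro sum.cong refl chain_cong)
    fix X :: "('a \<times> nat) list" and j assume X: "map fst X = b # cs"
    show "diffc (coc k) (rot p j X) = diffc (coc k) X"
      using good1[OF X] lenX[OF X] len
      by (intro diffc_rot[where l = "2 * k + 1"] coc_props(2)) auto
  qed
  finally have "chain p bs (coc (Suc k)) = chain p (b # cs) (diffc (coc k))"
    using p by simp
  also have "[\<dots> = chain p cs (coc k)] (mod int p)"
    by (rule chain_diffc[OF good1 len])
  also have "[chain p cs (coc k) = 1] (mod int p)"
    by (rule Suc.IH[OF good2 len])
  finally show ?case .
qed

text \<open>A pairing congruent to 1 is nonzero, so some list lies in the support of the cochain,
  and the support forces the level. Odd lengths use \<open>coc\<close>, even lengths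
  \<open>diffc\<close>.\<close>

theorem exists_high_level:
  assumes good: "\<And>X. map fst X = bs \<Longrightarrow> good X" and "bs \<noteq> []"
  shows "\<exists>X. map fst X = bs \<and> lev X \<ge> length bs"
proof -
  have nz: "c \<noteq> 0" if "[c = 1] (mod int p)" for c
    using that p by (auto simp: cong_def)
  show ?thesis
  proof (cases "odd (length bs)")
    case True
    then obtain k where len: "length bs = 2 * k + 1" by (rule oddE)
    obtain X where X: "map fst X = bs" "coc k X \<noteq> 0"
      using nz[OF chain_coc[OF good len]] by (rule chain_nonzero)
    then have "lev X \<ge> 2 * k + 1"
      using len by (intro coc_props(3) good) auto
    with X len show ?thesis by auto
  next
    case False
    with \<open>bs \<noteq> []\<close> obtain b cs where bs: "bs = b # cs" and "odd (length cs)"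
      by (cases bs) auto
    then obtain k where len: "length cs = 2 * k + 1" by (auto elim: oddE)
    have good': "good X" if "map fst X = cs" for X
      using that len by (intro good_sub[OF good[of "(b, 0) # X"]]) (auto simp: bs)
    have "[chain p bs (diffc (coc k)) = 1] (mod int p)"
      using chain_diffc[OF good[unfolded bs] len] chain_coc[OF good' len] unfolding bs
      by (rule cong_trans)
    from nz[OF this] obtain X where X: "map fst X = bs" "diffc (coc k) X \<noteq> 0"
      by (rule chain_nonzero)
    then have "lev X \<ge> Suc (2 * k + 1)"
      using len bs good[OF X(1)] by (intro diffc_lev[where F = "coc k"] coc_props(3)) auto
    with X(1) len bs show ?thesis by (intro exI[of _ X]) simp
  qed
qed

end

section \<open>The prime case\<close>

text \<open>Multisets are replaced by functions read only at indices below \<open>r\<close>, so that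
  \<open>Z/p\<close> can act by shifting indices.\<close>

definition balanced :: "nat \<Rightarrow> (nat \<Rightarrow> 'a set) \<Rightarrow> bool" where
  "balanced r N \<longleftrightarrow> (\<forall>i<r. \<forall>j<r. card (N i) \<le> Suc (card (N j)))"

definition fam_disjoint :: "nat \<Rightarrow> ('a \<Rightarrow> nat) \<Rightarrow> 'a set \<Rightarrow> (nat \<Rightarrow> 'a set) \<Rightarrow> bool" where
  "fam_disjoint r s V N \<longleftrightarrow> (\<forall>i\<in>V. card {j. j < r \<and> i \<in> N j} \<le> s i)"

definition edge_free :: "'a set set \<Rightarrow> 'a set \<Rightarrow> bool" where
  "edge_free E N \<longleftrightarrow> (\<forall>e\<in>E. \<not> e \<subseteq> N)"

definition eq_family :: "nat \<Rightarrow> ('a \<Rightarrow> nat) \<Rightarrow> 'a set \<Rightarrow> 'a set set \<Rightarrow> (nat \<Rightarrow> 'a set) \<Rightarrow> bool" where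
  "eq_family r s V E N \<longleftrightarrow>
     (\<forall>j<r. N j \<subseteq> V \<and> edge_free E (N j)) \<and> balanced r N \<and> fam_disjoint r s V N"

definition kneser_coloring ::
    "nat \<Rightarrow> ('a \<Rightarrow> nat) \<Rightarrow> 'a set \<Rightarrow> 'a set set \<Rightarrow> nat \<Rightarrow> ('a set \<Rightarrow> nat) \<Rightarrow> bool" where
  "kneser_coloring r s V E C c \<longleftrightarrow> (\<forall>e\<in>E. c e < C) \<and>
     (\<forall>f. (\<forall>j<r. f j \<in> E) \<and> fam_disjoint r s V f \<longrightarrow> \<not> (\<exists>k. \<forall>j<r. c (f j) = k))"

lemma fam_disjoint_mono:
  assumes "fam_disjoint r s V N" "\<And>j. j < r \<Longrightarrow> M j \<subseteq> N j"
  shows "fam_disjoint r s V M"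
  unfolding fam_disjoint_def
proof
  fix i assume "i \<in> V"
  have "card {j. j < r \<and> i \<in> M j} \<le> card {j. j < r \<and> i \<in> N j}"
    by (rule card_mono) (simp, use assms(2) in blast)
  also have "\<dots> \<le> s i" using assms(1) \<open>i \<in> V\<close> by (simp add: fam_disjoint_def)
  finally show "card {j. j < r \<and> i \<in> M j} \<le> s i" .
qed

lemma eq_family_empty:
  assumes "\<And>e. e \<in> E \<Longrightarrow> e \<noteq> {}"
  shows "eq_family r s V E (\<lambda>_. {})"
  using assms by (auto simp: eq_family_def balanced_def fam_disjoint_def edge_free_def)

section \<open>Shifts modulo p and the sign of a word\<close>

lemma inj_on_shift: "inj_on (\<lambda>j. (j + k) mod p) {..<p :: nat}"
proof (rule inj_onI)
  fix i j assume "i \<in> {..<p}" "j \<in> {..<p}" "(i + k) mod p = (j + k) mod p"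
  then have "[i + k = j + k] (mod p)" by (simp only: cong_def)
  then have "[i = j] (mod p)" by (simp only: cong_add_rcancel_nat)
  with \<open>i \<in> {..<p}\<close> \<open>j \<in> {..<p}\<close> show "i = j" by (simp add: cong_def)
qed

lemma image_shift: "p > 0 \<Longrightarrow> (\<lambda>j. (j + k) mod p) ` {..<p :: nat} = {..<p}"
  by (intro card_subset_eq) (auto simp: card_image inj_on_shift)

lemma shift_cases:
  assumes "j < (p :: nat)"
  obtains i where "i < p" "j = (i + k) mod p"
proof -
  have "j \<in> (\<lambda>j. (j + k) mod p) ` {..<p}" using assms by (subst image_shift) auto
  then show ?thesis using that by auto
qed

lemma image_shift_eq:
  assumes "p > 0" and "\<And>j. j < p \<Longrightarrow> w' ((j + k) mod p) = w j"
  shows "w' ` {..<p :: nat} = w ` {..<p}"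
proof -
  have "w ` {..<p} = (\<lambda>j. w' ((j + k) mod p)) ` {..<p}"
    using assms(2) by (intro image_cong) auto
  also have "\<dots> = w' ` (\<lambda>j. (j + k) mod p) ` {..<p}" by (simp only: image_image)
  finally show ?thesis by (simp only: image_shift[OF assms(1)])
qed

text \<open>A nonconstant word of length \<open>p\<close> receives an equivariant sign: a letter occurring in it
  (chosen depending only on the set of letters) has \<open>b\<close> occurrences with \<open>0 < b < p\<close>, and a
  shift by \<open>k\<close> changes the sum of their positions by \<open>b k\<close>.\<close>

definition word_sign :: "nat \<Rightarrow> (nat \<Rightarrow> 'b) \<Rightarrow> int" where
  "word_sign p w =
     (let B = {j. j < p \<and> w j = (SOME y. y \<in> w ` {..<p})}
      in (SOME u. [u * int (card B) = 1] (mod int p)) * (\<Sum>j\<in>B. int j))"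

lemma word_sign_cong:
  assumes "\<And>j. j < p \<Longrightarrow> w j = w' j"
  shows "word_sign p w = word_sign p w'"
proof -
  have "w ` {..<p} = w' ` {..<p}" using assms by (intro image_cong) auto
  moreover have "{j. j < p \<and> w j = y} = {j. j < p \<and> w' j = y}" for y using assms by auto
  ultimately show ?thesis by (simp only: word_sign_def)
qed

lemma word_sign_shift:
  assumes p: "prime p" and shift: "\<And>j. j < p \<Longrightarrow> w' ((j + k) mod p) = w j"
    and ne: "i < p" "j < p" "w i \<noteq> w j"
  shows "[word_sign p w' = word_sign p w + int k] (mod int p)"
proof -
  have p0: "p > 0" using ne by simp
  have im: "w' ` {..<p} = w ` {..<p}"
    using p0 shift by (rule image_shift_eq)
  define y where "y = (SOME y. y \<in> w ` {..<p})"
  define B where "B = {j. j < p \<and> w j = y}"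
  define B' where "B' = {j. j < p \<and> w' j = y}"
  \<comment> \<open>The inverse modulo \<open>p\<close> of the number of occurrences, which rescales
    the change of the sum of positions to \<open>k\<close>. Primality of \<open>p\<close> gives its
    existence.\<close>
  define u where "u = (SOME u. [u * int (card B) = 1] (mod int p))"
  have "w 0 \<in> w ` {..<p}" using p0 by simp
  then have "y \<in> w ` {..<p}" unfolding y_def by (rule someI)
  then have "B \<noteq> {}" unfolding B_def by auto
  have fin: "finite B" unfolding B_def by simp
  have "B \<subseteq> {..<p}" unfolding B_def by blast
  moreover have "\<not> (i \<in> B \<and> j \<in> B)" using ne(3) unfolding B_def mem_Collect_eq by metis
  ultimately have "B \<subset> {..<p}" using ne(1,2) by blast
  then have "card B < p" using psubset_card_mono[of "{..<p}" B] by simp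
  moreover have "0 < card B" using \<open>B \<noteq> {}\<close> fin by (simp add: card_gt_0_iff)
  ultimately have "\<not> p dvd card B" by (simp add: nat_dvd_not_less)
  with p have "coprime p (card B)" by (rule prime_imp_coprime)
  then have "coprime (int (card B)) (int p)" by (simp add: coprime_commute)
  then obtain u' where "[int (card B) * u' = 1] (mod int p)"
    using cong_solve_coprime_int by blast
  then have "\<exists>u. [u * int (card B) = 1] (mod int p)" by (metis mult.commute)
  then have u: "[u * int (card B) = 1] (mod int p)"
    unfolding u_def by (rule someI_ex)
  have B': "B' = (\<lambda>j. (j + k) mod p) ` B"
  proof
    show "B' \<subseteq> (\<lambda>j. (j + k) mod p) ` B"
    proof
      fix x assume x: "x \<in> B'"
      then have "x < p" by (simp add: B'_def)
      then obtain i where "i < p" "x = (i + k) mod p" by (rule shift_cases)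
      then show "x \<in> (\<lambda>j. (j + k) mod p) ` B"
        using x shift[of i] by (auto simp: B_def B'_def)
    qed
  qed (use shift p0 in \<open>auto simp: B_def B'_def\<close>)
  have inj: "inj_on (\<lambda>j. (j + k) mod p) B"
    using inj_on_shift by (rule inj_on_subset) (auto simp: B_def)
  have card: "card B' = card B" unfolding B' by (rule card_image[OF inj])
  have "(\<Sum>j\<in>B'. int j) = (\<Sum>j\<in>B. (int j + int k) mod int p)"
    unfolding B' by (subst sum.reindex[OF inj]) (simp add: zmod_int)
  also have "[\<dots> = (\<Sum>j\<in>B. int j + int k)] (mod int p)"
    by (intro cong_sum) simp
  also have "(\<Sum>j\<in>B. int j + int k) = (\<Sum>j\<in>B. int j) + int (card B) * int k"
    by (simp add: sum.distrib)
  finally have "[u * (\<Sum>j\<in>B'. int j) = u * ((\<Sum>j\<in>B. int j) + int (card B) * int k)] (mod int p)"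
    by (intro cong_mult cong_refl)
  also have "u * ((\<Sum>j\<in>B. int j) + int (card B) * int k)
      = u * (\<Sum>j\<in>B. int j) + (u * int (card B)) * int k"
    by (simp add: distrib_left mult.assoc)
  also have "[\<dots> = u * (\<Sum>j\<in>B. int j) + 1 * int k] (mod int p)"
    by (intro cong_add cong_mult cong_refl u)
  also have "u * (\<Sum>j\<in>B'. int j) = word_sign p w'"
    unfolding word_sign_def im u_def B'_def[symmetric] y_def[symmetric] Let_def card by simp
  also have "u * (\<Sum>j\<in>B. int j) = word_sign p w"
    unfolding word_sign_def u_def B_def y_def Let_def by simp
  finally show ?thesis by simp
qed

text \<open>\<open>\<alpha>\<close> may be any upper bound for the total sizes of equitable
  edge-free families; its value is fixed only in \<open>eq_family_prime\<close>.\<close>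

locale prime_coloring =
  fixes p :: nat and s :: "'a \<Rightarrow> nat" and V :: "'a set" and E :: "'a set set"
    and C :: nat and c :: "'a set \<Rightarrow> nat" and \<alpha> :: nat
  assumes p: "prime p" and finV: "finite V" and s: "\<And>i. i \<in> V \<Longrightarrow> s i < p"
    and col: "kneser_coloring p s V E C c"
    and small: "\<And>N. eq_family p s V E N \<Longrightarrow> (\<Sum>j<p. card (N j)) \<le> \<alpha>"
begin

lemma p_gt_1: "p > 1"
  using p by (rule prime_gt_1_nat)

text \<open>The cardinalities of the members of a largest balanced subfamily.\<close>

definition trunc :: "(nat \<Rightarrow> 'a set) \<Rightarrow> nat \<Rightarrow> nat" where
  "trunc N j = min (card (N j)) (Suc (Min ((\<lambda>j. card (N j)) ` {..<p})))"

definition clean :: "(nat \<Rightarrow> 'a set) \<Rightarrow> bool" where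
  "clean N \<longleftrightarrow> (\<forall>j<p. edge_free E (N j))"

definition cols :: "(nat \<Rightarrow> 'a set) \<Rightarrow> nat \<Rightarrow> nat set" where
  "cols N j = c ` {e \<in> E. e \<subseteq> N j}"

definition nonconst :: "(nat \<Rightarrow> 'b) \<Rightarrow> bool" where
  "nonconst w \<longleftrightarrow> (\<exists>i<p. \<exists>j<p. w i \<noteq> w j)"

lemma nonconst_cong: "(\<And>j. j < p \<Longrightarrow> w j = w' j) \<Longrightarrow> nonconst w = nonconst w'"
  by (simp add: nonconst_def cong: conj_cong)

lemma word_sign_nonconst:
  assumes "nonconst w" and "\<And>j. j < p \<Longrightarrow> w' ((j + k) mod p) = w j"
  shows "[word_sign p w' = word_sign p w + int k] (mod int p)"
proof -
  from assms(1) obtain i j where "i < p" "j < p" "w i \<noteq> w j" by (auto simp: nonconst_def)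
  with p assms(2) show ?thesis by (rule word_sign_shift)
qed

definition level :: "(nat \<Rightarrow> 'a set) \<Rightarrow> nat" where
  "level N = (if clean N then \<Sum>j<p. trunc N j else \<alpha> + (\<Sum>j<p. card (cols N j)))"

text \<open>Each case reads the sign from data that cannot change along a chain of constant level:
  the colour sets, the truncated sizes or, when these sizes all agree, the family itself.\<close>

definition sign :: "(nat \<Rightarrow> 'a set) \<Rightarrow> int" where
  "sign N = (if \<not> clean N then word_sign p (cols N)
             else if nonconst (trunc N) then word_sign p (trunc N) else word_sign p N)"

definition admissible :: "(nat \<Rightarrow> 'a set) \<Rightarrow> bool" where
  "admissible N \<longleftrightarrow> (\<forall>j<p. N j \<subseteq> V) \<and> fam_disjoint p s V N \<and> (\<exists>j<p. N j \<noteq> {})"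

section \<open>Levels and signs of admissible families\<close>

lemma Min_le: "j < p \<Longrightarrow> Min ((\<lambda>j. card (N j)) ` {..<p}) \<le> card (N j)"
  by (intro Min.coboundedI) auto

lemma Min_attained: obtains i where "i < p" "Min ((\<lambda>j. card (N j)) ` {..<p}) = card (N i)"
proof -
  have "Min ((\<lambda>j. card (N j)) ` {..<p}) \<in> (\<lambda>j. card (N j)) ` {..<p}"
    using p_gt_1 by (intro Min_in) (auto simp: lessThan_empty_iff)
  then show ?thesis using that by auto
qed

lemma finite_member: "admissible N \<Longrightarrow> j < p \<Longrightarrow> finite (N j)"
  using finV unfolding admissible_def by (meson finite_subset)

text \<open>This makes the action free: if all members agreed, some point would lie in
  \<open>p\<close> of them, against \<open>s i < p\<close>.\<close>

lemma nonconst_admissible: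
  assumes "admissible N"
  shows "nonconst N"
proof (rule ccontr)
  assume const: "\<not> nonconst N"
  from assms obtain j i where j: "j < p" "i \<in> N j" "i \<in> V"
    by (auto simp: admissible_def)
  then have "i \<in> N j'" if "j' < p" for j'
    using const that unfolding nonconst_def by blast
  then have "{j. j < p \<and> i \<in> N j} = {..<p}" by blast
  then have "p \<le> s i" using assms j by (auto simp: admissible_def fam_disjoint_def)
  with s[OF j(3)] show False by simp
qed

text \<open>Edges of colour \<open>k\<close>, one inside each member, would inherit
  \<open>s\<close>-disjointness and form a monochromatic edge of the Kneser hypergraph.\<close>

lemma color_missing:
  assumes "admissible N"
  shows "\<exists>j<p. k \<notin> cols N j"
proof (rule ccontr)
  assume "\<not> ?thesis"
  then have "\<forall>j<p. \<exists>e. e \<in> E \<and> e \<subseteq> N j \<and> c e = k" by (fastforce simp: cols_def)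
  then obtain f where f: "\<And>j. j < p \<Longrightarrow> f j \<in> E \<and> f j \<subseteq> N j \<and> c (f j) = k" by metis
  have "fam_disjoint p s V f"
    using assms f by (intro fam_disjoint_mono[of p s V N f]) (auto simp: admissible_def)
  with f col show False unfolding kneser_coloring_def by blast
qed

lemma cols_subset: "cols N j \<subseteq> {..<C}"
  using col by (auto simp: cols_def kneser_coloring_def)

lemma finite_cols: "finite (cols N j)"
  using cols_subset by (rule finite_subset) simp

lemma nonconst_cols:
  assumes "admissible N" "\<not> clean N"
  shows "nonconst (cols N)"
proof -
  from assms(2) obtain j k where "j < p" "k \<in> cols N j"
    by (auto simp: clean_def edge_free_def cols_def)
  with color_missing[OF assms(1), of k] show ?thesis unfolding nonconst_def by metis
qed

text \<open>A smallest member is not truncated, so the common value is the minimum; any larger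
  member would be truncated to a value above it.\<close>

lemma trunc_eq_Min:
  assumes "\<not> nonconst (trunc N)" "j < p"
  shows "card (N j) = Min ((\<lambda>j. card (N j)) ` {..<p})"
proof -
  obtain i where i: "i < p" "Min ((\<lambda>j. card (N j)) ` {..<p}) = card (N i)"
    by (rule Min_attained)
  then have "trunc N i = card (N i)" by (simp add: trunc_def)
  moreover have "trunc N j = trunc N i" using assms i(1) unfolding nonconst_def by blast
  ultimately show ?thesis using i(2) by (simp add: trunc_def min_def split: if_splits)
qed

lemma trunc_mono:
  assumes N: "admissible N" and sub: "\<And>j. j < p \<Longrightarrow> M j \<subseteq> N j" and j: "j < p"
  shows "trunc M j \<le> trunc N j"
proof -
  have le: "card (M j) \<le> card (N j)" if "j < p" for j
    using sub that finite_member[OF N] by (intro card_mono) auto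
  obtain i where i: "i < p" "Min ((\<lambda>j. card (N j)) ` {..<p}) = card (N i)"
    by (rule Min_attained)
  have "Min ((\<lambda>j. card (M j)) ` {..<p}) \<le> Min ((\<lambda>j. card (N j)) ` {..<p})"
    using Min_le[OF i(1), of M] le[OF i(1)] i(2) by simp
  with le[OF j] show ?thesis unfolding trunc_def by (intro min.mono) auto
qed

text \<open>Subsets of the truncated sizes form an equitable family, since these sizes are the
  minimum or one more.\<close>

lemma sum_trunc_le:
  assumes N: "admissible N" "clean N"
  shows "(\<Sum>j<p. trunc N j) \<le> \<alpha>"
proof -
  have "\<exists>B. B \<subseteq> N j \<and> card B = trunc N j" for j
    unfolding trunc_def by (meson obtain_subset_with_card_n min.cobounded1)
  then obtain M where M: "\<And>j. M j \<subseteq> N j" "\<And>j. card (M j) = trunc N j" by metis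
  have "eq_family p s V E M"
    unfolding eq_family_def
  proof (intro conjI allI impI)
    fix j assume j: "j < p"
    show "M j \<subseteq> V" using M(1)[of j] N(1) j by (auto simp: admissible_def)
    have "edge_free E (N j)" using N(2) j by (simp add: clean_def)
    then show "edge_free E (M j)" using M(1)[of j] by (auto simp: edge_free_def)
  next
    show "balanced p M"
      unfolding balanced_def M(2)
      using Min_le[of _ N] by (auto simp: trunc_def min_le_iff_disj)
    show "fam_disjoint p s V M"
      using N M(1) by (intro fam_disjoint_mono[of p s V N M]) (auto simp: admissible_def)
  qed
  from small[OF this] show ?thesis by (simp add: M(2))
qed

lemma level_le:
  assumes "admissible N"
  shows "level N \<le> \<alpha> + C * (p - 1)"
proof (cases "clean N")
  case True
  with sum_trunc_le[OF assms] show ?thesis by (simp add: level_def)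
next
  case False
  have "(\<Sum>j<p. card (cols N j)) = (\<Sum>j<p. \<Sum>k<C. of_bool (k \<in> cols N j))"
    using cols_subset by (intro sum.cong) (auto simp: Int_absorb1 Int_commute)
  also have "\<dots> = (\<Sum>k<C. \<Sum>j<p. of_bool (k \<in> cols N j))"
    by (rule sum.swap)
  also have "\<dots> \<le> (\<Sum>k<C. p - 1)"
  proof (rule sum_mono)
    fix k
    obtain j where j: "j < p" "k \<notin> cols N j" using color_missing[OF assms] by blast
    have "(\<Sum>j<p. of_bool (k \<in> cols N j)) = card {j. j < p \<and> k \<in> cols N j}"
      by (simp add: Int_def)
    also have "\<dots> \<le> card ({..<p} - {j})" using j by (intro card_mono) auto
    also have "\<dots> = p - 1" using j by simp
    finally show "(\<Sum>j<p. of_bool (k \<in> cols N j)) \<le> p - 1" .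
  qed
  finally show ?thesis using False by (simp add: level_def)
qed

lemma sum_cols_pos:
  assumes "\<not> clean N"
  shows "(\<Sum>j<p. card (cols N j)) > 0"
proof -
  from assms obtain j where j: "j < p" "cols N j \<noteq> {}"
    by (auto simp: clean_def edge_free_def cols_def)
  then have "card (cols N j) > 0" by (simp add: card_gt_0_iff finite_cols)
  with j(1) show ?thesis by (intro sum_pos2[of _ j]) auto
qed

lemma level_pos:
  assumes "admissible N"
  shows "level N > 0"
proof (cases "clean N")
  case True
  from assms obtain j where j: "j < p" "N j \<noteq> {}" by (auto simp: admissible_def)
  then have "trunc N j > 0"
    using finite_member[OF assms j(1)] by (simp add: trunc_def card_gt_0_iff)
  with j(1) have "(\<Sum>j<p. trunc N j) > 0" by (intro sum_pos2[of _ j]) auto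
  with True show ?thesis by (simp add: level_def)
qed (use sum_cols_pos in \<open>auto simp: level_def\<close>)

lemma sum_mono_eq:
  assumes le: "\<And>j. j < p \<Longrightarrow> f j \<le> g j" and eq: "(\<Sum>j<p. f j) = (\<Sum>j<p. g j :: nat)" and "j < p"
  shows "f j = g j"
  using assms sum_mono_inv[OF eq] by auto

text \<open>Levels are sums of monotone terms, so equal levels force equal terms; passing from a
  clean to an unclean family crosses \<open>\<alpha>\<close> strictly.\<close>

lemma level_mono:
  assumes M: "admissible M" and N: "admissible N" and sub: "\<And>j. j < p \<Longrightarrow> M j \<subseteq> N j"
  shows "level M \<le> level N" and "level M = level N \<Longrightarrow> sign M = sign N"
proof -
  have "level M \<le> level N \<and> (level M = level N \<longrightarrow> sign M = sign N)"
  proof (cases "clean N")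
    case cN: True
    then have cM: "clean M" using sub by (fastforce simp: clean_def edge_free_def)
    have le: "\<And>j. j < p \<Longrightarrow> trunc M j \<le> trunc N j" by (rule trunc_mono[OF N sub])
    moreover have "sign M = sign N" if eq: "(\<Sum>j<p. trunc M j) = (\<Sum>j<p. trunc N j)"
    proof -
      have t: "trunc M j = trunc N j" if "j < p" for j using sum_mono_eq[OF le eq that] .
      then have nc: "nonconst (trunc M) = nonconst (trunc N)" by (rule nonconst_cong)
      show ?thesis
      proof (cases "nonconst (trunc N)")
        case True
        with nc cM cN show ?thesis by (simp add: sign_def word_sign_cong[OF t])
      next
        case False
        \<comment> \<open>With constant truncated sizes nothing is cut off, so the nested sets have
          equal size.\<close>
        have eq: "M j = N j" if j: "j < p" for j
        proof (rule card_subset_eq[OF finite_member[OF N j] sub[OF j]])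
          have "trunc M j = card (M j)" "trunc N j = card (N j)"
            using trunc_eq_Min[OF False j] trunc_eq_Min[of M j] nc False j
            by (simp_all add: trunc_def)
          with t[OF j] show "card (M j) = card (N j)" by simp
        qed
        with False nc cM cN show ?thesis by (simp add: sign_def word_sign_cong[OF eq])
      qed
    qed
    ultimately show ?thesis using cM cN by (auto simp: level_def intro: sum_mono)
  next
    case cN: False
    show ?thesis
    proof (cases "clean M")
      case True
      with sum_trunc_le[OF M True] sum_cols_pos[OF cN] cN show ?thesis
        by (simp add: level_def)
    next
      case cM: False
      have sub: "cols M j \<subseteq> cols N j" if "j < p" for j
        using sub[OF that] by (auto simp: cols_def)
      then have le: "card (cols M j) \<le> card (cols N j)" if "j < p" for j
        using that by (intro card_mono finite_cols) auto
      moreover have "sign M = sign N"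
        if eq: "(\<Sum>j<p. card (cols M j)) = (\<Sum>j<p. card (cols N j))"
      proof -
        have "cols M j = cols N j" if j: "j < p" for j
          using sum_mono_eq[OF le eq j] by (intro card_subset_eq finite_cols sub j)
        from word_sign_cong[OF this] cM cN show ?thesis by (simp add: sign_def)
      qed
      ultimately show ?thesis using cM cN by (auto simp: level_def intro: sum_mono)
    qed
  qed
  then show "level M \<le> level N" "level M = level N \<Longrightarrow> sign M = sign N" by auto
qed

lemma sign_shift:
  assumes N: "admissible N" and shift: "\<And>j. j < p \<Longrightarrow> N' ((j + k) mod p) = N j"
  shows "[sign N' = sign N + int k] (mod int p)"
proof -
  have p0: "p > 0" using p_gt_1 by simp
  have all: "(\<forall>j<p. P (N' j)) \<longleftrightarrow> (\<forall>j<p. P (N j))" for P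
    using shift shift_cases[of _ p k] p0 by (metis mod_less_divisor)
  have cl: "clean N' = clean N" unfolding clean_def by (rule all)
  have "(\<lambda>j. card (N' j)) ` {..<p} = (\<lambda>j. card (N j)) ` {..<p}"
    by (rule image_shift_eq[OF p0, of _ k]) (simp add: shift)
  then have tr: "trunc N' ((j + k) mod p) = trunc N j" if "j < p" for j
    using shift[OF that] by (simp add: trunc_def)
  have co: "cols N' ((j + k) mod p) = cols N j" if "j < p" for j
    using shift[OF that] by (simp add: cols_def)
  have nc: "nonconst (trunc N') = nonconst (trunc N)"
    unfolding nonconst_def using tr shift_cases[of _ p k] p0 by (metis mod_less_divisor)
  have "[word_sign p N' = word_sign p N + int k] (mod int p)"
    using nonconst_admissible[OF N] shift by (rule word_sign_nonconst)
  moreover have "[word_sign p (trunc N') = word_sign p (trunc N) + int k] (mod int p)"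
    if "nonconst (trunc N)" using that tr by (rule word_sign_nonconst)
  moreover have "[word_sign p (cols N') = word_sign p (cols N) + int k] (mod int p)"
    if "\<not> clean N" using nonconst_cols[OF N that] co by (rule word_sign_nonconst)
  ultimately show ?thesis unfolding sign_def cl nc by (simp split: if_split)
qed

text \<open>The label of a vertex names the member that receives its point. It is read modulo
  \<open>p\<close>, since labels in a list are arbitrary natural numbers.\<close>

definition parts :: "('a \<times> nat) list \<Rightarrow> nat \<Rightarrow> 'a set" where
  "parts X j = {i. \<exists>x. (i, x) \<in> set X \<and> x mod p = j}"

lemma parts_mono: "set Y \<subseteq> set X \<Longrightarrow> parts Y j \<subseteq> parts X j"
  by (auto simp: parts_def)

lemma parts_rot:
  assumes "j < p"
  shows "parts (rot p k X) ((j + k) mod p) = parts X j"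
proof -
  have "(x + k) mod p = (j + k) mod p \<longleftrightarrow> x mod p = j" for x
    using cong_add_rcancel_nat[of x k j p] assms by (simp add: cong_def)
  then show ?thesis by (force simp: parts_def rot_def)
qed

lemma card_parts_le: "card {j. j < p \<and> i \<in> parts X j} \<le> count (mset (map fst X)) i"
proof -
  have "{j. j < p \<and> i \<in> parts X j} \<subseteq> (\<lambda>v. snd v mod p) ` set (filter (\<lambda>v. fst v = i) X)"
    by (force simp: parts_def)
  then have "card {j. j < p \<and> i \<in> parts X j}
      \<le> card ((\<lambda>v. snd v mod p) ` set (filter (\<lambda>v. fst v = i) X))"
    by (intro card_mono) auto
  also have "\<dots> \<le> card (set (filter (\<lambda>v. fst v = i) X))"
    by (rule card_image_le) simp
  also have "\<dots> \<le> length (filter (\<lambda>v. fst v = i) X)" by (rule card_length)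
  also have "\<dots> = count (mset (map fst X)) i" by (induction X) auto
  finally show ?thesis .
qed

lemma admissible_parts:
  assumes bs: "\<And>i. count (mset bs) i \<le> (if i \<in> V then s i else 0)"
    and X: "X \<noteq> []" "mset (map fst X) \<subseteq># mset bs"
  shows "admissible (parts X)"
  unfolding admissible_def
proof (intro conjI allI impI)
  have cnt: "count (mset (map fst X)) i \<le> (if i \<in> V then s i else 0)" for i
    using bs[of i] X(2) by (metis le_trans mset_subset_eq_count)
  show "parts X j \<subseteq> V" for j
  proof
    fix i assume "i \<in> parts X j"
    then have "i \<in># mset (map fst X)" by (force simp: parts_def)
    then have "count (mset (map fst X)) i > 0" by (simp only: count_greater_zero_iff)
    with cnt[of i] show "i \<in> V" by (metis not_le)
  qed
  show "fam_disjoint p s V (parts X)"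
    unfolding fam_disjoint_def
  proof
    fix i assume "i \<in> V"
    with cnt[of i] have "count (mset (map fst X)) i \<le> s i" by (simp only: if_True)
    with card_parts_le[of i X] show "card {j. j < p \<and> i \<in> parts X j} \<le> s i"
      by (rule le_trans)
  qed
  obtain i x Y where "X = (i, x) # Y" using X(1) by (metis list.exhaust surj_pair)
  then have "i \<in> parts X (x mod p)" by (auto simp: parts_def)
  moreover have "x mod p < p" using p_gt_1 by simp
  ultimately show "\<exists>j<p. parts X j \<noteq> {}" by blast
qed

theorem sum_s_le:
  assumes "V \<noteq> {}" "\<And>i. i \<in> V \<Longrightarrow> s i > 0"
  shows "(\<Sum>i\<in>V. s i) \<le> \<alpha> + C * (p - 1)"
proof -
  \<comment> \<open>Listing each \<open>i\<close> with multiplicity \<open>s i\<close> encodes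
    \<open>s\<close>-disjointness: a nonempty list over a submultiset puts \<open>i\<close> into at
    most \<open>s i\<close> parts.\<close>
  obtain bs where bs: "mset bs = (\<Sum>i\<in>V. replicate_mset (s i) i)" by (metis ex_mset)
  have cnt: "count (mset bs) i = (if i \<in> V then s i else 0)" for i
    unfolding bs using finV by (simp add: count_sum)
  have len: "length bs = (\<Sum>i\<in>V. s i)"
    unfolding size_mset[symmetric] bs by (simp add: size_multiset_sum)
  obtain v where "v \<in> V" using assms(1) by blast
  then have "(\<Sum>i\<in>V. s i) > 0" using assms(2) finV by (intro sum_pos2[of _ v]) auto
  then have "bs \<noteq> []" using len by auto
  define good where "good X \<longleftrightarrow> X \<noteq> [] \<and> mset (map fst X) \<subseteq># mset bs"
    for X :: "('a \<times> nat) list"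
  have adm: "admissible (parts X)" if "good X" for X
    using that cnt by (intro admissible_parts[of bs]) (auto simp: good_def)
  interpret equivariant_sign p good "\<lambda>X. sign (parts X)" "\<lambda>X. level (parts X)"
  proof
    show "p > 1" by (rule p_gt_1)
    show sub: "good Y" if "good X" "mset Y \<subseteq># mset X" "Y \<noteq> []" for X Y
      using that image_mset_subseteq_mono[OF that(2), of fst]
      by (auto simp: good_def intro: subset_mset.order_trans)
    show "good (rot p k X)" if "good X" for X k
      using that by (auto simp: good_def simp del: mset_map) (auto simp: rot_def)
    show "[sign (parts (rot p k X)) = sign (parts X) + int k] (mod int p)" if "good X" for X k
      by (intro sign_shift adm that parts_rot)
    show "level (parts X) > 0" if "good X" for X
      by (intro level_pos adm that)
    show "level (parts Y) < level (parts X)"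
      if "good X" "mset Y \<subseteq># mset X" "Y \<noteq> []"
        "\<not> [sign (parts Y) = sign (parts X)] (mod int p)" for X Y
    proof -
      have "set Y \<subseteq> set X" using set_mset_mono[OF that(2)] by simp
      then have "parts Y j \<subseteq> parts X j" for j by (rule parts_mono)
      from level_mono[OF adm[OF sub[OF that(1-3)]] adm[OF that(1)] this] that(4)
      show ?thesis by (metis cong_refl le_neq_implies_less)
    qed
  qed
  have good: "good X" if "map fst X = bs" for X
    using that \<open>bs \<noteq> []\<close> by (auto simp: good_def simp del: mset_map)
  from exists_high_level[OF good \<open>bs \<noteq> []\<close>] obtain X
    where X: "map fst X = bs" "level (parts X) \<ge> length bs" by blast
  have "level (parts X) \<le> \<alpha> + C * (p - 1)" by (intro level_le adm good X(1))
  with X(2) len show ?thesis by simp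
qed

end

lemma eq_family_prime:
  assumes p: "prime p" and finV: "finite V" and s_bounds: "\<And>i. i \<in> V \<Longrightarrow> 0 < s i \<and> s i < p"
    and E: "\<And>e. e \<in> E \<Longrightarrow> e \<noteq> {}" and col: "kneser_coloring p s V E C c"
  shows "\<exists>N. eq_family p s V E N \<and> (\<Sum>i\<in>V. s i) \<le> (\<Sum>j<p. card (N j)) + C * (p - 1)"
proof (rule ccontr)
  assume "\<not> ?thesis"
  then have less: "(\<Sum>j<p. card (N j)) + C * (p - 1) < (\<Sum>i\<in>V. s i)"
    if "eq_family p s V E N" for N
    using that by (metis not_less)
  have pos: "C * (p - 1) < (\<Sum>i\<in>V. s i)"
    using less[OF eq_family_empty[OF E]] by simp
  \<comment> \<open>This makes \<open>\<alpha> + C * (p - 1)\<close> one less than the sum of the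
    \<open>s i\<close>; by \<open>pos\<close> the subtraction is not truncated.\<close>
  define \<alpha> where "\<alpha> = (\<Sum>i\<in>V. s i) - 1 - C * (p - 1)"
  interpret prime_coloring p s V E C c \<alpha>
  proof
    show "(\<Sum>j<p. card (N j)) \<le> \<alpha>" if "eq_family p s V E N" for N
      using less[OF that] by (simp add: \<alpha>_def)
  qed (use p finV s_bounds col in auto)
  have "V \<noteq> {}" using pos by auto
  then have "(\<Sum>i\<in>V. s i) \<le> \<alpha> + C * (p - 1)" using s_bounds by (intro sum_s_le) auto
  with pos show False by (simp add: \<alpha>_def)
qed

section \<open>Products of primes\<close>

text \<open>The index \<open>m\<close> encodes the pair \<open>(m div q, m mod q)\<close>. For each
  \<open>j\<close> a point lies in at most one \<open>G j l\<close>, so its indices inject into the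
  \<open>j\<close> with \<open>i \<in> g j\<close>.\<close>

lemma fam_disjoint_combine:
  assumes g: "fam_disjoint p s V g"
    and G: "\<And>j. j < p \<Longrightarrow> fam_disjoint q (\<lambda>_. 1) (g j) (G j)"
    and sub: "\<And>j l. j < p \<Longrightarrow> l < q \<Longrightarrow> G j l \<subseteq> g j"
  shows "fam_disjoint (p * q) s V (\<lambda>m. G (m div q) (m mod q))"
  unfolding fam_disjoint_def
proof
  fix i assume i: "i \<in> V"
  define A where "A = {m. m < p * q \<and> i \<in> G (m div q) (m mod q)}"
  have A: "m div q < p" "m mod q < q" "i \<in> G (m div q) (m mod q)" if "m \<in> A" for m
  proof -
    have m: "m < p * q" "i \<in> G (m div q) (m mod q)" using that by (auto simp: A_def)
    then show "m div q < p" by (simp add: less_mult_imp_div_less)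
    show "m mod q < q" using m(1) by (cases "q = 0") auto
    show "i \<in> G (m div q) (m mod q)" by (rule m(2))
  qed
  have "inj_on (\<lambda>m. m div q) A"
  proof (rule inj_onI)
    fix m m' assume m: "m \<in> A" "m' \<in> A" "m div q = m' div q"
    let ?L = "{l. l < q \<and> i \<in> G (m div q) l}"
    have "i \<in> g (m div q)" using sub A[OF m(1)] by blast
    then have "card ?L \<le> 1" using G[OF A(1)[OF m(1)]] by (simp add: fam_disjoint_def)
    moreover have "m mod q \<in> ?L" "m' mod q \<in> ?L" using A[OF m(1)] A[OF m(2)] m(3) by auto
    ultimately have "m mod q = m' mod q" by (auto simp: card_le_Suc0_iff_eq)
    with m(3) show "m = m'" by (metis div_mult_mod_eq)
  qed
  then have "card A = card ((\<lambda>m. m div q) ` A)" by (simp add: card_image)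
  also have "\<dots> \<le> card {j. j < p \<and> i \<in> g j}"
  proof (rule card_mono)
    show "(\<lambda>m. m div q) ` A \<subseteq> {j. j < p \<and> i \<in> g j}" using A sub by blast
  qed simp
  also have "\<dots> \<le> s i" using g i by (simp add: fam_disjoint_def)
  finally show "card {m. m < p * q \<and> i \<in> G (m div q) (m mod q)} \<le> s i"
    by (simp only: A_def)
qed

lemma sum_div_mod:
  fixes f :: "nat \<Rightarrow> nat \<Rightarrow> nat"
  assumes "q > 0"
  shows "(\<Sum>m<p * q. f (m div q) (m mod q)) = (\<Sum>j<p. \<Sum>l<q. f j l)"
proof -
  have "(\<Sum>m<p * q. f (m div q) (m mod q))
      = (\<Sum>j<p. sum (\<lambda>m. f (m div q) (m mod q)) {j * q..<j * q + q})"
    by (simp only: sum.nat_group)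
  also have "\<dots> = (\<Sum>j<p. \<Sum>l<q. f j l)"
  proof (rule sum.cong[OF refl])
    fix j
    have "sum (\<lambda>m. f (m div q) (m mod q)) {j * q..<j * q + q}
        = (\<Sum>l=0..<q. f ((l + j * q) div q) ((l + j * q) mod q))"
      using sum.shift_bounds_nat_ivl[of "\<lambda>m. f (m div q) (m mod q)" 0 "j * q" q]
      by (simp add: add.commute)
    also have "\<dots> = (\<Sum>l=0..<q. f j l)" using assms by (intro sum.cong) auto
    finally show "sum (\<lambda>m. f (m div q) (m mod q)) {j * q..<j * q + q} = (\<Sum>l<q. f j l)"
      by (simp only: atLeast0LessThan)
  qed
  finally show ?thesis .
qed

text \<open>If \<open>card (M i)\<close> exceeded \<open>card (N j)\<close> by two, then
  \<open>Suc (card (N j))\<close> would bound all sizes in \<open>M\<close> from below and all sizes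
  in \<open>N\<close> from above, strictly once each, and the totals would differ by at least
  two.\<close>

lemma balanced_combine:
  assumes M: "balanced q M" and N: "balanced q N"
    and le: "(\<Sum>l<q. card (M l)) \<le> Suc (\<Sum>l<q. card (N l))" and i: "i < q" and j: "j < q"
  shows "card (M i) \<le> Suc (card (N j))"
proof (rule ccontr)
  assume "\<not> ?thesis"
  then have big: "card (M i) \<ge> Suc (Suc (card (N j)))" by simp
  have lower: "Suc (card (N j)) \<le> card (M l)" if "l < q" for l
  proof -
    have "card (M i) \<le> Suc (card (M l))" using M i that by (auto simp: balanced_def)
    with big show ?thesis by simp
  qed
  have upper: "card (N l) \<le> Suc (card (N j))" if "l < q" for l
    using N j that by (auto simp: balanced_def)
  have "(\<Sum>l<q. Suc (card (N j))) < (\<Sum>l<q. card (M l))"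
    using i big lower by (intro sum_strict_mono_ex1) (auto intro!: bexI[of _ i])
  moreover have "(\<Sum>l<q. card (N l)) < (\<Sum>l<q. Suc (card (N j)))"
    using j upper by (intro sum_strict_mono_ex1) (auto intro!: bexI[of _ j])
  ultimately show False using le by linarith
qed

text \<open>Removing a point from a largest member keeps the family balanced. The control over
  totals prepares \<open>balanced_combine\<close>.\<close>

lemma eq_family_trim:
  assumes finV: "finite V" and "eq_family r s V E N" and "t \<le> (\<Sum>j<r. card (N j))"
  shows "\<exists>M. eq_family r s V E M \<and> (\<Sum>j<r. card (M j)) = t"
  using assms(2,3)
proof (induction "(\<Sum>j<r. card (N j)) - t" arbitrary: N)
  case 0
  then have "(\<Sum>j<r. card (N j)) = t" by simp
  with 0 show ?case by blast
next
  case (Suc d)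
  have pos: "(\<Sum>j<r. card (N j)) > t" using Suc.hyps(2) by simp
  have "{..<r} \<noteq> {}" using pos by (intro notI) simp
  then have "Max ((\<lambda>j. card (N j)) ` {..<r}) \<in> (\<lambda>j. card (N j)) ` {..<r}"
    by (intro Max_in) auto
  then obtain j where j: "j < r" "card (N j) = Max ((\<lambda>j. card (N j)) ` {..<r})" by fastforce
  have max: "card (N i) \<le> card (N j)" if "i < r" for i
    unfolding j(2) using that by (intro Max_ge) auto
  have "card (N j) \<noteq> 0"
  proof
    assume "card (N j) = 0"
    then have "(\<Sum>j<r. card (N j)) = 0" using max by simp
    with pos show False by simp
  qed
  then have fin: "finite (N j)" by (intro card_ge_0_finite) simp
  from \<open>card (N j) \<noteq> 0\<close> have "N j \<noteq> {}" by (intro notI) simp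
  then obtain x where x: "x \<in> N j" by blast
  define M where "M = N(j := N j - {x})"
  have cj: "Suc (card (M j)) = card (N j)"
    unfolding M_def fun_upd_same by (rule card_Suc_Diff1[OF fin x])
  have ci: "M i = N i" if "i \<noteq> j" for i using that by (simp add: M_def)
  have sub: "M i \<subseteq> N i" for i by (simp add: M_def)
  have "(\<Sum>i\<in>{..<r} - {j}. card (M i)) = (\<Sum>i\<in>{..<r} - {j}. card (N i))"
    by (intro sum.cong) (auto simp: ci)
  then have sum: "Suc (\<Sum>i<r. card (M i)) = (\<Sum>i<r. card (N i))"
    using j(1) cj by (simp add: sum.remove[of "{..<r}" j])
  have "eq_family r s V E M"
    unfolding eq_family_def
  proof (intro conjI allI impI)
    fix i assume i: "i < r"
    have "N i \<subseteq> V" "edge_free E (N i)"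
      using Suc.prems(1) i unfolding eq_family_def by blast+
    then show "M i \<subseteq> V" "edge_free E (M i)"
      using sub[of i] unfolding edge_free_def by blast+
  next
    have bal: "balanced r N" using Suc.prems(1) by (simp add: eq_family_def)
    show "balanced r M"
      unfolding balanced_def
    proof (intro allI impI)
      fix i k assume ik: "i < r" "k < r"
      have le: "card (M i) \<le> card (N i)"
        using cj ci[of i] by (cases "i = j") auto
      show "card (M i) \<le> Suc (card (M k))"
      proof (cases "k = j")
        case True
        then show ?thesis using le max[OF ik(1)] cj by simp
      next
        case False
        have "card (N i) \<le> Suc (card (N k))" using bal ik by (simp add: balanced_def)
        with le ci[OF False] show ?thesis by simp
      qed
    qed
    show "fam_disjoint r s V M"
      using Suc.prems(1) sub by (intro fam_disjoint_mono[of r s V N M]) (auto simp: eq_family_def)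
  qed
  moreover have "d = (\<Sum>j<r. card (M j)) - t" "t \<le> (\<Sum>j<r. card (M j))"
    using sum pos Suc.hyps(2) by auto
  ultimately show ?case using Suc.hyps(1)[of M] by blast
qed

lemma largest_prime_factor_props:
  assumes "r \<ge> 2"
  shows "prime (largest_prime_factor r)" "largest_prime_factor r dvd r"
    "largest_prime_factor r \<le> r"
proof -
  have "prime_factors r \<noteq> {}"
    using assms prime_factor_nat[of r] by (auto simp: prime_factors_dvd)
  then have "largest_prime_factor r \<in> prime_factors r"
    unfolding largest_prime_factor_def by (intro Max_in) auto
  then show "prime (largest_prime_factor r)" "largest_prime_factor r dvd r"
    by (auto simp: prime_factors_dvd)
  then show "largest_prime_factor r \<le> r" using assms by (intro dvd_imp_le) auto
qed

theorem eq_family_exists: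
  assumes "finite V" "r \<ge> 2" "\<And>i. i \<in> V \<Longrightarrow> 0 < s i \<and> s i < largest_prime_factor r"
    and "\<And>e. e \<in> E \<Longrightarrow> e \<noteq> {}" "kneser_coloring r s V E C c"
  shows "\<exists>N. eq_family r s V E N \<and> (\<Sum>i\<in>V. s i) \<le> (\<Sum>j<r. card (N j)) + C * (r - 1)"
  using assms
proof (induction r arbitrary: V s E c rule: less_induct)
  case (less r)
  note finV = less.prems(1) and s = less.prems(3) and E = less.prems(4) and col = less.prems(5)
  define p where "p = largest_prime_factor r"
  have p: "prime p" "p dvd r" using largest_prime_factor_props[OF less.prems(2)] by (auto simp: p_def)
  then obtain q where r: "r = p * q" by (auto elim: dvdE)
  have p1: "p > 1" using p(1) by (rule prime_gt_1_nat)
  have s': "0 < s i \<and> s i < p" if "i \<in> V" for i using s[OF that] unfolding p_def .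
  show ?case
  proof (cases "q = 1")
    case True
    then have rp: "r = p" using r by simp
    show ?thesis using eq_family_prime[OF p(1) finV s' E col[unfolded rp]] unfolding rp .
  next
    case False
    have "q \<noteq> 0" using less.prems(2) r by (intro notI) simp
    with False have q: "q \<ge> 2" by simp
    have qr: "q < r" unfolding r using p1 q by simp
    define T where "T = {W. W \<subseteq> V \<and> \<not> (\<exists>N. eq_family q (\<lambda>_. 1) W E N \<and>
                          card W \<le> (\<Sum>j<q. card (N j)) + C * (q - 1))}"
    have "\<exists>f k. (\<forall>l<q. f l \<in> E \<and> f l \<subseteq> W \<and> c (f l) = k) \<and> fam_disjoint q (\<lambda>_. 1) W f"
      if W: "W \<in> T" for W
    proof (rule ccontr)
      assume none: "\<not> ?thesis"
      let ?E = "{e \<in> E. e \<subseteq> W}"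
      have "kneser_coloring q (\<lambda>_. 1) W ?E C c"
        unfolding kneser_coloring_def
      proof (intro conjI allI impI)
        show "\<forall>e\<in>?E. c e < C" using col by (simp add: kneser_coloring_def)
        fix f assume "(\<forall>l<q. f l \<in> ?E) \<and> fam_disjoint q (\<lambda>_. 1) W f"
        with none show "\<not> (\<exists>k. \<forall>l<q. c (f l) = k)" by blast
      qed
      moreover have "finite W" using W finV by (auto simp: T_def intro: finite_subset)
      \<comment> \<open>The induction hypothesis for \<open>q\<close> is used with all bounds equal
        to 1, so the largest prime factor of \<open>q\<close> only has to exceed 1.\<close>
      moreover have "1 < largest_prime_factor q"
        using largest_prime_factor_props(1)[OF q] by (rule prime_gt_1_nat)
      ultimately obtain N where N: "eq_family q (\<lambda>_. 1) W ?E N"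
        "(\<Sum>i\<in>W. 1) \<le> (\<Sum>j<q. card (N j)) + C * (q - 1)"
        using less.IH[OF qr _ q, of W "\<lambda>_. 1" ?E c] E by auto
      have "eq_family q (\<lambda>_. 1) W E N"
        using N(1) unfolding eq_family_def edge_free_def by blast
      with N(2) W show False by (auto simp: T_def)
    qed
    then obtain F K where F: "\<And>W l. W \<in> T \<Longrightarrow> l < q \<Longrightarrow> F W l \<in> E \<and> F W l \<subseteq> W \<and> c (F W l) = K W"
      and F_disj: "\<And>W. W \<in> T \<Longrightarrow> fam_disjoint q (\<lambda>_. 1) W (F W)" by metis
    have "kneser_coloring p s V T C K"
      unfolding kneser_coloring_def
    proof (intro conjI allI impI ballI notI)
      fix W assume "W \<in> T"
      from F[OF this, of 0] q show "K W < C" using col by (auto simp: kneser_coloring_def)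
    next
      fix g assume "(\<forall>j<p. g j \<in> T) \<and> fam_disjoint p s V g" and "\<exists>k. \<forall>j<p. K (g j) = k"
      then obtain k where g: "\<And>j. j < p \<Longrightarrow> g j \<in> T" "fam_disjoint p s V g"
        and k: "\<And>j. j < p \<Longrightarrow> K (g j) = k" by blast
      define f where "f m = F (g (m div q)) (m mod q)" for m
      have "fam_disjoint (p * q) s V f"
        unfolding f_def using g F F_disj by (intro fam_disjoint_combine) auto
      moreover have "f m \<in> E" "c (f m) = k" if "m < r" for m
      proof -
        have "m div q < p" using that r by (simp add: less_mult_imp_div_less)
        moreover have "m mod q < q" using q by simp
        ultimately show "f m \<in> E" "c (f m) = k"
          unfolding f_def using F g(1) k by auto
      qed
      ultimately show False using col unfolding kneser_coloring_def r by blast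
    qed
    \<comment> \<open>The empty family keeps the empty set out of \<open>T\<close>, whose members
      serve as edges.\<close>
    moreover have "W \<noteq> {}" if "W \<in> T" for W
      using that eq_family_empty[of E q "\<lambda>_. 1" "{}"] E by (auto simp: T_def)
    ultimately obtain M where M: "eq_family p s V T M"
      "(\<Sum>i\<in>V. s i) \<le> (\<Sum>j<p. card (M j)) + C * (p - 1)"
      using eq_family_prime[OF p(1) finV, where s = s and E = T and C = C and c = K] s' by blast
    \<comment> \<open>Trimming to exactly this total transfers the balance of \<open>M\<close> to
      the totals: they differ by at most one, also where the subtraction is cut off at zero.\<close>
    have "\<exists>N. eq_family q (\<lambda>_. 1) (M j) E N \<and> (\<Sum>l<q. card (N l)) = card (M j) - C * (q - 1)"
      if j: "j < p" for j
    proof -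
      have MV: "M j \<subseteq> V" and "edge_free T (M j)" using M(1) j by (auto simp: eq_family_def)
      then have "M j \<notin> T" by (auto simp: edge_free_def)
      with MV obtain N where N: "eq_family q (\<lambda>_. 1) (M j) E N"
        "card (M j) \<le> (\<Sum>l<q. card (N l)) + C * (q - 1)" by (auto simp: T_def)
      have "finite (M j)" using MV finV by (rule finite_subset)
      from eq_family_trim[OF this N(1), of "card (M j) - C * (q - 1)"] N(2) show ?thesis by simp
    qed
    then obtain G where G: "\<And>j. j < p \<Longrightarrow> eq_family q (\<lambda>_. 1) (M j) E (G j)"
      and G_sum: "\<And>j. j < p \<Longrightarrow> (\<Sum>l<q. card (G j l)) = card (M j) - C * (q - 1)" by metis
    define N where "N m = G (m div q) (m mod q)" for m
    have dm: "m div q < p" "m mod q < q" if "m < r" for m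
      using that r q by (auto simp: less_mult_imp_div_less)
    have "eq_family r s V E N"
      unfolding eq_family_def
    proof (intro conjI allI impI)
      fix m assume "m < r"
      note m = dm[OF this]
      show "N m \<subseteq> V" using G[OF m(1)] M(1) m unfolding N_def eq_family_def by blast
      show "edge_free E (N m)" using G[OF m(1)] m unfolding N_def eq_family_def by blast
    next
      show "balanced r N"
        unfolding balanced_def N_def
      proof (intro allI impI)
        fix i j assume ij: "i < r" "j < r"
        have "card (M (i div q)) \<le> Suc (card (M (j div q)))"
          using M(1) dm ij by (auto simp: eq_family_def balanced_def)
        then have "(\<Sum>l<q. card (G (i div q) l)) \<le> Suc (\<Sum>l<q. card (G (j div q) l))"
          using G_sum dm ij by simp
        then show "card (G (i div q) (i mod q)) \<le> Suc (card (G (j div q) (j mod q)))"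
          using G dm ij by (intro balanced_combine[of q]) (auto simp: eq_family_def)
      qed
      show "fam_disjoint r s V N"
        unfolding N_def r
      proof (rule fam_disjoint_combine)
        show "fam_disjoint p s V M" using M(1) by (simp add: eq_family_def)
      qed (use G in \<open>auto simp: eq_family_def\<close>)
    qed
    moreover have "(\<Sum>i\<in>V. s i) \<le> (\<Sum>m<r. card (N m)) + C * (r - 1)"
    proof -
      have "(\<Sum>m<r. card (N m)) = (\<Sum>j<p. card (M j) - C * (q - 1))"
        unfolding r N_def using q G_sum by (subst sum_div_mod) auto
      moreover have "(\<Sum>j<p. card (M j)) \<le> (\<Sum>j<p. (card (M j) - C * (q - 1)) + C * (q - 1))"
        by (intro sum_mono) simp
      moreover have "(\<Sum>j<p. (card (M j) - C * (q - 1)) + C * (q - 1))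
          = (\<Sum>j<p. card (M j) - C * (q - 1)) + p * (C * (q - 1))"
        by (simp add: sum.distrib)
      \<comment> \<open>The losses add up: \<open>C * (q - 1)\<close> in each of the
        \<open>p\<close> groups, and \<open>C * (p - 1)\<close> from the prime case.\<close>
      moreover have "p * (C * (q - 1)) + C * (p - 1) = C * (r - 1)"
      proof -
        have "p * (q - 1) + (p - 1) = r - 1"
          using p1 q unfolding r by (cases q) (auto simp: algebra_simps)
        then show ?thesis by (metis distrib_left mult.left_commute)
      qed
      ultimately show ?thesis using M(2) by linarith
    qed
    ultimately show ?thesis by blast
  qed
qed

section \<open>From indexed families back to multisets\<close>

definition family_mset :: "nat \<Rightarrow> (nat \<Rightarrow> 'b) \<Rightarrow> 'b multiset" where
  "family_mset r N = image_mset N (mset_set {..<r})"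

lemma family_mset_simps [simp]:
  "size (family_mset r N) = r" "set_mset (family_mset r N) = N ` {..<r}"
  by (auto simp: family_mset_def)

lemma s_disjoint_family_mset:
  "s_disjoint V s (family_mset r N) \<longleftrightarrow> fam_disjoint r s V N"
proof -
  have "size {#A \<in># family_mset r N. i \<in> A#} = card {j. j < r \<and> i \<in> N j}" for i
    by (simp add: family_mset_def filter_mset_image_mset)
  then show ?thesis by (simp add: s_disjoint_def fam_disjoint_def)
qed

theorem ecd_le:
  assumes H: "hypergraph (V, E)" and r: "r \<ge> 2"
    and s: "\<And>i. i \<in> V \<Longrightarrow> 0 < s i \<and> s i < largest_prime_factor r"
    and c: "proper_coloring (kneser r s (V, E)) c" "c ` E \<subseteq> {..<k}"
  shows "ecd r s (V, E) \<le> int (k * (r - 1))"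
proof -
  have finV: "finite V" and E: "\<And>e. e \<in> E \<Longrightarrow> e \<noteq> {}" using H by (auto simp: hypergraph_def)
  have "kneser_coloring r s V E k c"
    unfolding kneser_coloring_def
  proof (intro conjI ballI allI impI notI)
    show "c e < k" if "e \<in> E" for e using c(2) that by auto
  next
    fix f assume f: "(\<forall>j<r. f j \<in> E) \<and> fam_disjoint r s V f" "\<exists>k. \<forall>j<r. c (f j) = k"
    then have "family_mset r f \<in> snd (kneser r s (V, E))"
      by (auto simp: kneser_def s_disjoint_family_mset)
    with c(1) f(2) show False by (auto simp: proper_coloring_def)
  qed
  from eq_family_exists[OF finV r s E this] obtain N where N: "eq_family r s V E N"
    "(\<Sum>i\<in>V. s i) \<le> (\<Sum>j<r. card (N j)) + k * (r - 1)" by blast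
  have sub: "N j \<subseteq> V" "edge_free E (N j)" if "j < r" for j
    using N(1) that by (auto simp: eq_family_def)
  have bal: "card (N i) \<le> Suc (card (N j))" if "i < r" "j < r" for i j
    using N(1) that by (auto simp: eq_family_def balanced_def)
  have "equitable (family_mset r N)"
    using bal by (fastforce simp: equitable_def abs_le_iff)
  then have "family_mset r N \<in> ecd_families r s (V, E)"
    using N(1) sub by (auto simp: ecd_families_def s_disjoint_family_mset eq_family_def
        induced_def edge_free_def)
  moreover have "(\<Sum>A\<in>#family_mset r N. card A) = (\<Sum>j<r. card (N j))"
    by (simp add: family_mset_def sum_unfold_sum_mset image_mset.compositionality comp_def)
  ultimately have "(\<Sum>j<r. card (N j)) \<in> {(\<Sum>A\<in>#M. card A) | M. M \<in> ecd_families r s (V, E)}"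
    by force
  with finite_nonempty_ecd_values(1)[OF H]
  have "(\<Sum>j<r. card (N j)) \<le> Max {(\<Sum>A\<in>#M. card A) | M. M \<in> ecd_families r s (V, E)}"
    by (rule Max_ge)
  then have "int (\<Sum>i\<in>V. s i)
      \<le> int (Max {(\<Sum>A\<in>#M. card A) | M. M \<in> ecd_families r s (V, E)}) + int (k * (r - 1))"
    using N(2) by linarith
  then show ?thesis by (simp add: ecd_def)
qed

theorem theorem3:
  fixes n r :: nat and s :: "nat \<Rightarrow> nat" and E :: "nat set set"
  assumes "hypergraph ({1..n}, E)"
    and "r \<ge> 2"
    and "\<forall>i\<in>{1..n}. 1 \<le> s i \<and> s i < largest_prime_factor r"
  shows "int (chromatic_number (kneser r s ({1..n}, E)))
           \<ge> \<lceil>real_of_int (ecd r s ({1..n}, E)) / (real r - 1)\<rceil>"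
proof -
  let ?k = "chromatic_number (kneser r s ({1..n}, E))"
  \<comment> \<open>A proper colouring with finitely many colours must exist for the minimum to be
    attained; this rests on \<open>s i < r\<close>.\<close>
  have "\<forall>i\<in>verts ({1..n}, E). s i < r"
    using assms(3) largest_prime_factor_props(3)[OF assms(2)] by auto
  then have "\<exists>k. \<exists>c :: nat set \<Rightarrow> nat. proper_coloring (kneser r s ({1..n}, E)) c \<and>
      c ` fst (kneser r s ({1..n}, E)) \<subseteq> {..<k}"
    using assms(1,2) by (intro kneser_colorable) auto
  then have "\<exists>c :: nat set \<Rightarrow> nat. proper_coloring (kneser r s ({1..n}, E)) c \<and>
      c ` fst (kneser r s ({1..n}, E)) \<subseteq> {..<?k}"
    unfolding chromatic_number_def by (rule LeastI_ex)
  then obtain c :: "nat set \<Rightarrow> nat" where c: "proper_coloring (kneser r s ({1..n}, E)) c"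
    "c ` E \<subseteq> {..<?k}" by (auto simp: kneser_def)
  have "ecd r s ({1..n}, E) \<le> int (?k * (r - 1))"
    using assms(3) by (intro ecd_le[OF assms(1,2) _ c]) (fastforce simp: Suc_le_eq)
  then have "real_of_int (ecd r s ({1..n}, E)) \<le> real_of_int (int (?k * (r - 1)))"
    by (simp only: of_int_le_iff)
  also have "\<dots> = real ?k * (real r - 1)"
    using assms(2) by (simp add: of_nat_diff)
  finally have "real_of_int (ecd r s ({1..n}, E)) / (real r - 1) \<le> real ?k"
    using assms(2) by (simp add: divide_le_eq)
  then show ?thesis by (simp add: ceiling_le_iff)
qed

end
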